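(* Let $K$ be a $4$-connected graph. Then every minimal planar cover of $K$ is $4$-connected.
   Context: All graphs are finite, simple and undirected. A graph $G$ is a cover of a graph $K$ if there is an onto map $\pi: V(G)\to V(K)$ (the covering projection) such that for every vertex $v$ of $G$, $\pi$ maps the set of neighbours of $v$ bijectively onto the set of neighbours of $\pi(v)$ in $K$. A cover is planar if it is a planar graph. A minimal planar cover of $K$ is a (finite) planar cover of $K$ with the smallest possible number of vertices among all planar covers of $K$. *)

theory Defs
  imports "HOL-Analysis.Analysis" "Graph_Theory.Pair_Digraph" "Graph_Theory.Digraph_Component"
begin

text \<open>
  A finite simple undirected graph is a \<^locale>\<open>pair_graph\<close>: a finite vertex set together with
  a finite, symmetric and irreflexive set of ordered pairs, each edge being present in both
  directions. The neighbourhood of \<open>v\<close> is \<open>parcs G `` {v}\<close>.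
\<close>

definition edges :: "'a pair_pre_digraph \<Rightarrow> 'a set set" where
  "edges G = {{u, v} | u v. (u, v) \<in> parcs G}"

text \<open>
  Both \<open>HOL-Analysis\<close> (topological spaces) and \<open>Graph_Theory\<close> have a constant called
  \<open>connected\<close>. The graph-theoretic one requires a non-empty vertex set.
\<close>

definition vertex_connected :: "nat \<Rightarrow> 'a pair_pre_digraph \<Rightarrow> bool" where
  "vertex_connected k G \<longleftrightarrow>
     card (pverts G) > k \<and>
     (\<forall>X \<subseteq> pverts G. card X < k \<longrightarrow>
        Digraph_Component.connected (with_proj G \<restriction> (pverts G - X)))"

text \<open>
  Vertices are drawn as points and edges as simple arcs in the plane. An arc meets the drawn
  vertices, and two distinct arcs meet each other, only in the points of common incident vertices.
\<close>

definition plane_drawing ::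
  "'a pair_pre_digraph \<Rightarrow> ('a \<Rightarrow> complex) \<Rightarrow> ('a set \<Rightarrow> real \<Rightarrow> complex) \<Rightarrow> bool" where
  "plane_drawing G p \<gamma> \<longleftrightarrow>
     inj_on p (pverts G) \<and>
     (\<forall>e \<in> edges G. arc (\<gamma> e) \<and> {pathstart (\<gamma> e), pathfinish (\<gamma> e)} = p ` e) \<and>
     (\<forall>e \<in> edges G. path_image (\<gamma> e) \<inter> p ` pverts G \<subseteq> p ` e) \<and>
     (\<forall>e \<in> edges G. \<forall>f \<in> edges G. e \<noteq> f \<longrightarrow>
        path_image (\<gamma> e) \<inter> path_image (\<gamma> f) \<subseteq> p ` (e \<inter> f))"

definition planar :: "'a pair_pre_digraph \<Rightarrow> bool" where
  "planar G \<longleftrightarrow> (\<exists>p \<gamma>. plane_drawing G p \<gamma>)"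

definition covering_projection ::
  "('a \<Rightarrow> 'b) \<Rightarrow> 'a pair_pre_digraph \<Rightarrow> 'b pair_pre_digraph \<Rightarrow> bool" where
  "covering_projection \<pi> G K \<longleftrightarrow>
     \<pi> ` pverts G = pverts K \<and>
     (\<forall>v \<in> pverts G. bij_betw \<pi> (parcs G `` {v}) (parcs K `` {\<pi> v}))"

definition planar_cover :: "'a pair_pre_digraph \<Rightarrow> 'b pair_pre_digraph \<Rightarrow> bool" where
  "planar_cover G K \<longleftrightarrow> pair_graph G \<and> planar G \<and> (\<exists>\<pi>. covering_projection \<pi> G K)"

text \<open>
  The competitors \<open>H\<close> range over graphs with natural numbers as vertices. Every finite graph is
  isomorphic to one of these, so the minimum is over all planar covers, whatever the type \<open>'a\<close>.
\<close>

definition minimal_planar_cover :: "'a pair_pre_digraph \<Rightarrow> 'b pair_pre_digraph \<Rightarrow> bool" where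
  "minimal_planar_cover G K \<longleftrightarrow>
     planar_cover G K \<and>
     (\<forall>H :: nat pair_pre_digraph. planar_cover H K \<longrightarrow> card (pverts G) \<le> card (pverts H))"

end

theory Submission
  imports Defs "HOL-Complex_Analysis.Riemann_Mapping"
begin

text \<open>
  Suppose that a minimal planar cover \<open>G\<close> of \<open>K\<close> has a vertex cut with at most three vertices, and
  let \<open>X\<close> be a smallest one, separating \<open>A\<close> from \<open>B\<close>. Since \<open>K\<close> remains connected after deleting
  \<open>\<pi> ` X\<close>, all other vertices of \<open>K\<close> have equally many lifts in \<open>A\<close>. Counting the lifts of an edge
  of \<open>K\<close> from both ends then shows that, for one of the two sides, say \<open>A\<close>, each neighbour \<open>v\<close> of
  \<open>y \<in> \<pi> ` X\<close> outside \<open>\<pi> ` X\<close> occurs in \<open>A\<close> as a neighbour of exactly one point of \<open>X\<close> over \<open>y\<close>,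
  and each neighbour inside \<open>\<pi> ` X\<close> of at most one. Hence \<open>A\<close>, together with one vertex for every
  point of \<open>\<pi> ` X\<close> and suitable edges between these new vertices, is a cover of \<open>K\<close> with fewer vertices
  than \<open>G\<close>. It is a minor of \<open>G\<close>: one contracts a component of \<open>B\<close>, or splits \<open>B\<close> to obtain a triangle
  on \<open>X\<close>, which is possible since \<open>G\<close> has no smaller cut. It remains to see that edge contraction
  preserves planarity for drawings by arbitrary arcs. By the Riemann mapping theorem, the
  complement of an arc in the plane is homeomorphic to the complement of a point.
\<close>

section \<open>Collapsing an arc in the plane\<close>

text \<open>Inversion at the endpoint \<open>a\<close> turns the rest of the arc into a closed
  connected unbounded set \<open>L\<close>, and infinity into 0. The complement of \<open>L\<close>
  is simply connected, hence homeomorphic to the plane by some \<open>f\<close>. A second inversion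
  at \<open>f 0\<close> restores infinity and squeezes the arc into 0.\<close>

lemma arc_collapse:
  fixes g :: "real \<Rightarrow> complex"
  assumes "arc g"
  shows "\<exists>h :: complex \<Rightarrow> complex. continuous_on UNIV h \<and>
    (\<forall>z. h z = 0 \<longleftrightarrow> z \<in> path_image g) \<and> inj_on h (- path_image g)"
proof -
  define P where "P = path_image g"
  define a where "a = pathstart g"
  define L where "L = (\<lambda>z. inverse (z - a)) ` (P - {a})"
  define \<Omega> where "\<Omega> = - L"
  have compP: "compact P" and conP: "Topological_Spaces.connected P"
    using assms by (auto simp: P_def compact_arc_image connected_arc_image)
  have aP: "a \<in> P" by (simp add: a_def P_def pathstart_in_path_image)
  have concP: "Topological_Spaces.connected (- P)"
    unfolding P_def by (rule connected_arc_complement) (use assms in auto)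
  have L_iff: "w \<in> L \<longleftrightarrow> w \<noteq> 0 \<and> a + inverse w \<in> P" for w
  proof
    assume "w \<noteq> 0 \<and> a + inverse w \<in> P"
    then show "w \<in> L"
      unfolding L_def by (intro image_eqI[of _ _ "a + inverse w"]) auto
  qed (auto simp: L_def)
  have "closed L"
  proof -
    obtain M where M: "M > 0" "\<And>z. z \<in> P \<Longrightarrow> norm (z - a) \<le> M"
    proof -
      have "bounded ((\<lambda>z. z - a) ` P)"
        using compP compact_imp_bounded bounded_translation_minus by blast
      then show ?thesis using that unfolding bounded_pos by auto
    qed
    show ?thesis unfolding closed_sequential_limits
    proof safe
      fix s w assume s: "\<forall>n. s n \<in> L" and lim: "s \<longlonglongrightarrow> w"
      \<comment> \<open>As \<open>P\<close> is bounded, \<open>L\<close> keeps a positive distance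
        from 0, so the limit \<open>w\<close> can be inverted.\<close>
      have "1 / M \<le> norm (s n)" for n
      proof -
        have "norm (inverse (s n)) \<le> M"
          using s M(2)[of "a + inverse (s n)"] L_iff by auto
        moreover have "norm (s n) > 0" using s L_iff by auto
        ultimately show ?thesis using M(1) by (simp add: norm_divide field_simps)
      qed
      then have "1 / M \<le> norm w"
        by (intro LIMSEQ_le_const[OF tendsto_norm[OF lim]]) auto
      then have w: "w \<noteq> 0" using M by auto
      have "(\<lambda>n. a + inverse (s n)) \<longlonglongrightarrow> a + inverse w"
        using lim w by (intro tendsto_intros)
      moreover have "a + inverse (s n) \<in> P" for n using s L_iff by auto
      ultimately have "a + inverse w \<in> P"
        using closed_sequentially[OF compact_imp_closed[OF compP], of "\<lambda>n. a + inverse (s n)"] by simp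
      then show "w \<in> L" using w L_iff by auto
    qed
  qed
  then have op: "open \<Omega>" by (simp add: \<Omega>_def open_Compl)
  have conL: "Topological_Spaces.connected L"
  proof -
    \<comment> \<open>Without its end \<open>a\<close> the arc is half-open and still
      connected.\<close>
    have "P - {a} = g ` {0<..1}"
    proof -
      have "inj_on g {0..1}" using assms by (simp add: arc_def)
      then have "g t \<noteq> a" if "0 < t" "t \<le> 1" for t
        using that inj_onD[of g "{0..1}" t 0] unfolding a_def pathstart_def by auto
      then have "a \<notin> g ` {0<..1}" by (metis greaterThanAtMost_iff imageE)
      moreover have "{0..1} = insert 0 {0<..1::real}" by auto
      then have "P = insert a (g ` {0<..1})"
        by (simp add: P_def path_image_def a_def pathstart_def)
      ultimately show ?thesis by simp
    qed
    moreover have "continuous_on {0<..1} g"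
      using assms unfolding arc_def path_def by (meson continuous_on_subset greaterThanAtMost_subseteq_atLeastAtMost_iff order_refl)
    ultimately have "Topological_Spaces.connected (P - {a})"
      by (metis connected_continuous_image connected_Ioc)
    then show ?thesis unfolding L_def
      by (intro connected_continuous_image continuous_intros) auto
  qed
  have unbL: "\<not> bounded L"
  proof
    assume "bounded L"
    then obtain B where B: "B > 0" "\<And>w. w \<in> L \<Longrightarrow> norm w \<le> B" unfolding bounded_pos by auto
    have "pathfinish g \<in> P" "pathfinish g \<noteq> a"
      using assms by (auto simp: P_def a_def arc_distinct_ends)
    then have "a islimpt P"
      using connected_imp_perfect[OF conP] aP by (metis singletonD)
    then obtain z where z: "z \<in> P" "z \<noteq> a" "dist z a < 1 / B"
      using B(1) unfolding islimpt_approachable by (meson zero_less_divide_1_iff)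
    then have "norm (inverse (z - a)) \<le> B" by (intro B(2)) (auto simp: L_def)
    moreover have "norm (z - a) > 0" using z by auto
    ultimately show False using z B(1) by (simp add: norm_divide dist_norm field_simps)
  qed
  \<comment> \<open>The inverted complement of the arc is \<Omega> without 0, and 0 is one of its
    limit points.\<close>
  have con\<Omega>: "Topological_Spaces.connected \<Omega>"
  proof (rule connected_intermediate_closure)
    show "Topological_Spaces.connected ((\<lambda>z. inverse (z - a)) ` (- P))"
      using aP by (intro connected_continuous_image concP continuous_intros) auto
    have eq: "(\<lambda>z. inverse (z - a)) ` (- P) = \<Omega> - {0}"
    proof safe
      fix z assume "z \<notin> P" then show "inverse (z - a) \<in> \<Omega>" by (simp add: \<Omega>_def L_iff)
    next
      fix z assume "z \<notin> P" "inverse (z - a) = 0" then show False using aP by auto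
    next
      fix w assume "w \<in> \<Omega>" "w \<notin> (\<lambda>z. inverse (z - a)) ` (- P)"
      then show "w = 0"
        by (metis (no_types, lifting) Compl_iff L_iff \<Omega>_def add_diff_cancel_left' image_eqI inverse_inverse_eq)
    qed
    then show "(\<lambda>z. inverse (z - a)) ` (- P) \<subseteq> \<Omega>" by auto
    have "0 islimpt \<Omega>" using op by (intro interior_limit_point) (auto simp: interior_open \<Omega>_def L_iff)
    then have "0 islimpt \<Omega> - {0}" using islimpt_punctured by blast
    then show "\<Omega> \<subseteq> closure ((\<lambda>z. inverse (z - a)) ` (- P))"
      unfolding eq closure_def by auto
  qed
  have "L \<noteq> {}" using unbL by auto
  then have "components (- \<Omega>) = {L}"
    using conL by (simp add: \<Omega>_def components_eq_sing_iff)
  then have "simply_connected \<Omega>"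
    using simply_connected_eq_unbounded_complement_components[OF op] con\<Omega> unbL by auto
  moreover have 0: "0 \<in> \<Omega>" by (simp add: \<Omega>_def L_iff)
  ultimately have "\<Omega> homeomorphic (UNIV :: complex set)"
    using simply_connected_eq_homeomorphic_to_disc[OF op] homeomorphic_ball01_UNIV homeomorphic_trans
    by blast
  then obtain f k :: "complex \<Rightarrow> complex" where fk: "homeomorphism \<Omega> UNIV f k" unfolding homeomorphic_def by auto
  have kf: "k (f w) = w" if "w \<in> \<Omega>" for w using fk that by (auto simp: homeomorphism_def)
  define h where "h z = (if z \<in> P then 0 else inverse (f (inverse (z - a)) - f 0))" for z
  have in\<Omega>: "inverse (z - a) \<in> \<Omega>" if "z \<notin> P" for z
    using that by (simp add: \<Omega>_def L_iff)
  have nz: "f (inverse (z - a)) \<noteq> f 0" if "z \<notin> P" for z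
    by (metis "0" aP eq_iff_diff_eq_0 in\<Omega> inverse_nonzero_iff_nonzero kf that)
  have h0: "h z = 0 \<longleftrightarrow> z \<in> P" for z using nz by (auto simp: h_def)
  have "inj_on h (- P)"
  proof (rule inj_onI)
    fix y z assume yz: "y \<in> - P" "z \<in> - P" "h y = h z"
    then have "f (inverse (y - a)) = f (inverse (z - a))" by (simp add: h_def)
    then have "inverse (y - a) = inverse (z - a)" using kf in\<Omega> yz by (metis ComplD)
    then show "y = z" by auto
  qed
  moreover have "isCont h z0" for z0
  proof (cases "z0 \<in> P")
    case False
    have "continuous_on (- P) (\<lambda>z. inverse (f (inverse (z - a)) - f 0))"
    proof (intro continuous_intros)
      show "continuous_on (- P) (\<lambda>z. f (inverse (z - a)))"
        by (rule continuous_on_compose2[OF homeomorphism_cont1[OF fk]])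
          (use aP in\<Omega> in \<open>auto intro!: continuous_intros\<close>)
    qed (use aP nz in auto)
    then have "continuous_on (- P) h"
      by (rule continuous_on_eq) (auto simp: h_def)
    moreover have "open (- P)" using compP compact_imp_closed by blast
    ultimately show ?thesis using False continuous_on_eq_continuous_at by blast
  next
    case True
    have "eventually (\<lambda>z. norm (h z) < e) (at z0)" if "e > 0" for e
    proof -
      \<comment> \<open>Off the arc, \<open>norm (h z) < e\<close> holds as soon as
        \<open>inverse (z - a)\<close> avoids this compact set.\<close>
      define K where "K = k ` cball (f 0) (1 / e)"
      have K: "compact K" "K \<subseteq> \<Omega>"
        unfolding K_def using fk
        by (auto simp: homeomorphism_def intro!: compact_continuous_image intro: continuous_on_subset)
      \<comment> \<open>Near \<open>a\<close> the inverse is too large for \<open>K\<close>; near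
        any other point of the arc it tends to a point of \<open>L\<close>, which \<open>K\<close>
        misses.\<close>
      have "eventually (\<lambda>z. inverse (z - a) \<notin> K) (at z0)"
      proof (cases "z0 = a")
        case True
        obtain B where B: "B > 0" "\<And>w. w \<in> K \<Longrightarrow> norm w \<le> B"
          using compact_imp_bounded[OF K(1)] unfolding bounded_pos by auto
        have "inverse (z - a) \<notin> K" if "z \<noteq> a" "dist z a < 1 / B" for z
        proof
          assume "inverse (z - a) \<in> K"
          then have "norm (inverse (z - a)) \<le> B" by (rule B)
          moreover have "norm (z - a) > 0" using that by auto
          ultimately show False using that B(1) by (simp add: norm_divide dist_norm field_simps)
        qed
        then show ?thesis unfolding eventually_at True
          using B(1) by (intro exI[of _ "1 / B"]) auto
      next
        case False
        then have "inverse (z0 - a) \<in> - K" using \<open>z0 \<in> P\<close> K(2) by (auto simp: \<Omega>_def L_iff)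
        moreover have "((\<lambda>z. inverse (z - a)) \<longlongrightarrow> inverse (z0 - a)) (at z0)"
          using False by (auto intro!: tendsto_intros)
        moreover have "open (- K)" using K compact_imp_closed by blast
        ultimately show ?thesis by (auto dest: topological_tendstoD)
      qed
      then show ?thesis
      proof eventually_elim
        case (elim z)
        show ?case
        proof (cases "z \<in> P")
          case True
          then have "h z = 0" using h0 by simp
          then show ?thesis using that by simp
        next
          case False
          have "f (inverse (z - a)) \<notin> cball (f 0) (1 / e)"
            using elim in\<Omega>[OF False] kf unfolding K_def by (metis image_eqI)
          then have "norm (f (inverse (z - a)) - f 0) > 1 / e"
            by (simp add: dist_norm norm_minus_commute)
          moreover from this have "norm (f (inverse (z - a)) - f 0) > 0"
            using that by (meson less_trans zero_less_divide_1_iff)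
          ultimately show ?thesis using False that
            by (simp add: h_def norm_divide field_simps)
        qed
      qed
    qed
    moreover have "h z0 = 0" using True h0 by simp
    ultimately show ?thesis
      unfolding isCont_def tendsto_iff by simp
  qed
  ultimately show ?thesis using h0 unfolding P_def
    by (intro exI[of _ h]) (simp add: continuous_at_imp_continuous_on)
qed

section \<open>Planar minors\<close>

lemma pair_graph_iff:
  "pair_graph G \<longleftrightarrow> finite (pverts G) \<and> parcs G \<subseteq> pverts G \<times> pverts G \<and>
     sym (parcs G) \<and> irrefl (parcs G)"
proof
  assume "pair_graph G"
  then interpret pair_graph G .
  show "finite (pverts G) \<and> parcs G \<subseteq> pverts G \<times> pverts G \<and> sym (parcs G) \<and> irrefl (parcs G)"
    using pair_finite_verts pair_sym_arcs
    by (auto simp: irrefl_def symmetric_def arcs_ends_def arc_to_ends_def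
        dest: in_arcsD1 in_arcsD2 no_loops')
next
  assume *: "finite (pverts G) \<and> parcs G \<subseteq> pverts G \<times> pverts G \<and> sym (parcs G) \<and> irrefl (parcs G)"
  then have "finite (parcs G)" by (meson finite_SigmaI finite_subset)
  with * show "pair_graph G"
    by unfold_locales
      (auto simp: irrefl_def symmetric_def arcs_ends_def arc_to_ends_def)
qed

section \<open>Connected vertex sets\<close>

text \<open>Connectedness of the induced subgraph for symmetric \<open>E\<close>, phrased by cuts
  instead of paths so that it passes easily to images and unions. The empty set counts as
  linked.\<close>

definition linked :: "('a \<times> 'a) set \<Rightarrow> 'a set \<Rightarrow> bool" where
  "linked E S \<longleftrightarrow> (\<forall>T \<subseteq> S. T \<noteq> {} \<longrightarrow> T \<noteq> S \<longrightarrow> (\<exists>a \<in> T. \<exists>b \<in> S - T. (a, b) \<in> E))"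

lemma linkedD:
  assumes "linked E S" "T \<subseteq> S" "T \<noteq> {}" "T \<noteq> S"
  obtains a b where "a \<in> T" "b \<in> S - T" "(a, b) \<in> E"
  using assms unfolding linked_def by blast

lemma linked_singleton: "linked E {x}"
  unfolding linked_def by auto

lemma linked_Un:
  assumes "linked E S" "linked E T" "sym E" "a \<in> S" "b \<in> T" "(a, b) \<in> E"
  shows "linked E (S \<union> T)"
  unfolding linked_def
proof (intro allI impI)
  fix Q assume Q: "Q \<subseteq> S \<union> T" "Q \<noteq> {}" "Q \<noteq> S \<union> T"
  show "\<exists>a\<in>Q. \<exists>b\<in>S \<union> T - Q. (a, b) \<in> E"
  proof (cases "Q \<inter> S \<noteq> {} \<and> Q \<inter> S \<noteq> S \<or> Q \<inter> T \<noteq> {} \<and> Q \<inter> T \<noteq> T")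
    case True
    then show ?thesis
    proof
      assume "Q \<inter> S \<noteq> {} \<and> Q \<inter> S \<noteq> S"
      then show ?thesis using linkedD[OF assms(1), of "Q \<inter> S"] by blast
    next
      assume "Q \<inter> T \<noteq> {} \<and> Q \<inter> T \<noteq> T"
      then show ?thesis using linkedD[OF assms(2), of "Q \<inter> T"] by blast
    qed
  next
    case False
    moreover have "(b, a) \<in> E" using assms by (auto dest: symD)
    ultimately show ?thesis using Q assms(4-6) by blast
  qed
qed

lemma linked_insert:
  assumes "linked E S" "sym E" "a \<in> S" "(a, b) \<in> E"
  shows "linked E (insert b S)"
  using linked_Un[OF assms(1) linked_singleton assms(2,3) _ assms(4)] by simp

text \<open>A cut of the image pulls back along \<open>c\<close> to a cut of \<open>S\<close>. This
  keeps branch sets connected under contraction.\<close>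

lemma linked_image:
  assumes "linked E S"
  shows "linked (map_prod c c ` E - Id) (c ` S)"
  unfolding linked_def
proof (intro allI impI)
  fix T assume T: "T \<subseteq> c ` S" "T \<noteq> {}" "T \<noteq> c ` S"
  define Q where "Q = {s \<in> S. c s \<in> T}"
  have "Q \<subseteq> S" "Q \<noteq> {}" "Q \<noteq> S" using T by (auto simp: Q_def)
  with assms obtain a b where ab: "a \<in> Q" "b \<in> S - Q" "(a, b) \<in> E" by (rule linkedD)
  then have "(c a, c b) \<in> map_prod c c ` E" by (metis image_eqI map_prod_simp)
  moreover have "c a \<in> T" "c b \<in> c ` S - T" using ab by (auto simp: Q_def)
  ultimately show "\<exists>a\<in>T. \<exists>b\<in>c ` S - T. (a, b) \<in> map_prod c c ` E - Id"
    by (intro bexI[of _ "c a"] bexI[of _ "c b"]) auto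
qed

text \<open>A maximal linked subset containing \<open>b\<close> works: an edge leaving it inside
  \<open>S\<close> would let it grow.\<close>

lemma component_exists:
  assumes "finite S" "b \<in> S" "sym E"
  obtains D where "b \<in> D" "D \<subseteq> S" "linked E D" "\<And>d s. d \<in> D \<Longrightarrow> s \<in> S - D \<Longrightarrow> (d, s) \<notin> E"
proof -
  define \<D> where "\<D> = {D. b \<in> D \<and> D \<subseteq> S \<and> linked E D}"
  have "finite \<D>" by (rule finite_subset[of _ "Pow S"]) (use assms in \<open>auto simp: \<D>_def\<close>)
  moreover have "{b} \<in> \<D>" using assms linked_singleton by (auto simp: \<D>_def)
  ultimately obtain D where D: "D \<in> \<D>" "\<And>D'. D' \<in> \<D> \<Longrightarrow> D \<subseteq> D' \<Longrightarrow> D = D'"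
    using finite_has_maximal[of \<D>] by blast
  have "(d, s) \<notin> E" if "d \<in> D" "s \<in> S - D" for d s
  proof
    assume "(d, s) \<in> E"
    then have "insert s D \<in> \<D>" using D(1) that linked_insert assms(3) by (fastforce simp: \<D>_def)
    then show False using D(2) that by blast
  qed
  then show ?thesis using that D(1) by (auto simp: \<D>_def)
qed

section \<open>Edge contraction and minors\<close>

text \<open>Taking the image of the edge set merges parallel edges; subtracting \<open>Id\<close>
  deletes the loop left by the contracted edge.\<close>

definition contract :: "'a \<Rightarrow> 'a \<Rightarrow> 'a pair_pre_digraph \<Rightarrow> 'a pair_pre_digraph" where
  "contract u v G = \<lparr>pverts = pverts G - {v},
     parcs = map_prod (id(v := u)) (id(v := u)) ` parcs G - Id\<rparr>"

lemma pair_graph_contract: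
  assumes "pair_graph G" "(u, v) \<in> parcs G"
  shows "pair_graph (contract u v G)"
proof -
  have uv: "u \<noteq> v" "u \<in> pverts G" using assms by (auto simp: pair_graph_iff irrefl_def)
  have G: "finite (pverts G)" "parcs G \<subseteq> pverts G \<times> pverts G" "sym (parcs G)"
    using assms by (auto simp: pair_graph_iff)
  have "sym (map_prod (id(v := u)) (id(v := u)) ` parcs G - Id)"
  proof (rule symI)
    fix a b assume "(a, b) \<in> map_prod (id(v := u)) (id(v := u)) ` parcs G - Id"
    then obtain x y where "(x, y) \<in> parcs G" "a = (id(v := u)) x" "b = (id(v := u)) y" "a \<noteq> b"
      by auto
    moreover from this have "(y, x) \<in> parcs G" using G(3) by (auto dest: symD)
    ultimately show "(b, a) \<in> map_prod (id(v := u)) (id(v := u)) ` parcs G - Id"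
      by (auto intro!: image_eqI[of _ _ "(y, x)"])
  qed
  moreover have "map_prod (id(v := u)) (id(v := u)) ` parcs G - Id \<subseteq>
    (pverts G - {v}) \<times> (pverts G - {v})"
    using uv G(2) by (auto split: if_splits)
  ultimately show ?thesis
    using G(1) by (simp add: pair_graph_iff contract_def irrefl_def)
qed

text \<open>Apply a map of the plane that collapses exactly the arc of the contracted edge.\<close>

lemma planar_contract:
  assumes G: "pair_graph G" "(u, v) \<in> parcs G" "planar G"
  shows "planar (contract u v G)"
proof -
  define c where "c = id(v := u)"
  define G' where "G' = contract u v G"
  define e0 where "e0 = {u, v}"
  obtain p \<gamma> where D: "plane_drawing G p \<gamma>" using G(3) by (auto simp: planar_def)
  note D = D[unfolded plane_drawing_def]
  note inj = D[THEN conjunct1]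
    and arcs = bspec[OF D[THEN conjunct2, THEN conjunct1]]
    and verts = bspec[OF D[THEN conjunct2, THEN conjunct2, THEN conjunct1]]
    and cross = bspec[OF bspec[OF D[THEN conjunct2, THEN conjunct2, THEN conjunct2]], rule_format]
  have uv: "u \<noteq> v" "u \<in> pverts G" "v \<in> pverts G"
    using G by (auto simp: pair_graph_iff irrefl_def)
  have e0: "e0 \<in> edges G" using G(2) by (auto simp: e0_def edges_def)
  have edge_sub: "e \<subseteq> pverts G" if "e \<in> edges G" for e
    using that G(1) by (auto simp: edges_def pair_graph_iff)
  obtain h :: "complex \<Rightarrow> complex" where h: "continuous_on UNIV h" "\<And>z. h z = 0 \<longleftrightarrow> z \<in> path_image (\<gamma> e0)"
      "inj_on h (- path_image (\<gamma> e0))"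
    using arc_collapse[OF conjunct1[OF arcs[OF e0]]] by auto
  have hp: "h (p w) = 0 \<longleftrightarrow> w \<in> e0" if "w \<in> pverts G" for w
  proof
    assume "h (p w) = 0"
    then have "p w \<in> p ` e0" using h(2) verts e0 that by blast
    then show "w \<in> e0" using inj edge_sub[OF e0] that by (auto simp: inj_on_def)
  next
    assume "w \<in> e0"
    then have "p w \<in> {pathstart (\<gamma> e0), pathfinish (\<gamma> e0)}" using arcs[OF e0] by blast
    then have "p w \<in> path_image (\<gamma> e0)"
      by (metis insertE pathfinish_in_path_image pathstart_in_path_image singletonD)
    then show "h (p w) = 0" using h(2)[of "p w"] by blast
  qed
  have "h (p u) = 0" "h (p v) = 0" using hp uv by (simp_all add: e0_def)
  then have hc: "h (p (c w)) = h (p w)" for w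
    by (cases "w = v") (simp_all add: c_def)
  \<comment> \<open>The only value that \<open>h\<close> can repeat is 0, so new intersections can
    arise only at the merged vertex.\<close>
  have h_inj: "z = z'" if "h z = h z'" "h z \<noteq> 0" for z z'
  proof (rule inj_onD[OF h(3) that(1)])
    show "z \<in> - path_image (\<gamma> e0)" "z' \<in> - path_image (\<gamma> e0)"
      using that h(2) by (metis ComplI)+
  qed
  have h_0: "z \<in> p ` (e \<inter> e0)" if "e \<in> edges G" "e \<noteq> e0" "z \<in> path_image (\<gamma> e)" "h z = 0" for e z
    using cross[OF that(1) e0 that(2)] h(2) that by blast
  \<comment> \<open>Contraction may merge two edges into one; \<open>s\<close> selects one original
    edge to draw.\<close>
  have "\<exists>e. e \<in> edges G \<and> c ` e = e' \<and> e \<noteq> e0" if e': "e' \<in> edges G'" for e'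
  proof -
    obtain a b where ab: "(a, b) \<in> parcs G" "c a \<noteq> c b" "e' = {c a, c b}"
      using e' by (auto simp: G'_def contract_def edges_def c_def[symmetric])
    then have "c ` {a, b} = e'" by auto
    moreover have "{a, b} \<noteq> e0" using ab(2) by (auto simp: c_def e0_def doubleton_eq_iff split: if_splits)
    ultimately show ?thesis using ab by (auto simp: edges_def intro!: exI[of _ "{a, b}"])
  qed
  then obtain s where s: "\<And>e'. e' \<in> edges G' \<Longrightarrow> s e' \<in> edges G"
    "\<And>e'. e' \<in> edges G' \<Longrightarrow> c ` s e' = e'" "\<And>e'. e' \<in> edges G' \<Longrightarrow> s e' \<noteq> e0" by metis
  have img: "(h \<circ> p) ` e' = h ` p ` s e'" if "e' \<in> edges G'" for e'
  proof -
    have "(h \<circ> p) ` (c ` s e') = h ` p ` s e'"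
      using hc by (simp add: image_image)
    then show ?thesis using s(2)[OF that] by simp
  qed
  have u_in: "u \<in> e'" if "e' \<in> edges G'" "w \<in> s e'" "w \<in> e0" for e' w
    using s(2)[OF that(1)] that by (auto simp: c_def e0_def split: if_splits)
  have V': "pverts G' = pverts G - {v}" by (simp add: G'_def contract_def)
  have "plane_drawing G' (h \<circ> p) (\<lambda>e. h \<circ> \<gamma> (s e))"
    unfolding plane_drawing_def
  proof (intro conjI ballI impI)
    show "inj_on (h \<circ> p) (pverts G')"
    proof (rule inj_onI)
      fix w x assume *: "w \<in> pverts G'" "x \<in> pverts G'" "(h \<circ> p) w = (h \<circ> p) x"
      show "w = x"
      proof (cases "h (p w) = 0")
        case True
        then have "w \<in> e0" "x \<in> e0" using hp * V' by auto
        then show ?thesis using * V' by (auto simp: e0_def)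
      next
        case False
        then have "p w = p x" using h_inj * by auto
        then show ?thesis using inj * V' by (auto simp: inj_on_def)
      qed
    qed
  next
    fix e' assume e': "e' \<in> edges G'"
    define e where "e = s e'"
    have e: "e \<in> edges G" "e \<noteq> e0" using s e' by (auto simp: e_def)
    \<comment> \<open>A different edge shares at most one vertex with \<open>e0\<close>, so
      \<open>h\<close> stays injective on its arc.\<close>
    then have card: "w = x" if "w \<in> e \<inter> e0" "x \<in> e \<inter> e0" for w x
      using that by (auto simp: edges_def e0_def)
    have "inj_on h (path_image (\<gamma> e))"
    proof (rule inj_onI)
      fix y z assume *: "y \<in> path_image (\<gamma> e)" "z \<in> path_image (\<gamma> e)" "h y = h z"
      show "y = z"
      proof (cases "h y = 0")
        case True
        then have "y \<in> p ` (e \<inter> e0)" "z \<in> p ` (e \<inter> e0)" using h_0 e * by auto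
        then show ?thesis using card by blast
      qed (use * h_inj in auto)
    qed
    then show "Path_Connected.arc (h \<circ> \<gamma> (s e'))"
      using arcs[OF e(1)] unfolding Path_Connected.arc_def path_image_def e_def
      by (auto intro!: path_continuous_image comp_inj_on intro: continuous_on_subset[OF h(1)])
    show "{pathstart (h \<circ> \<gamma> (s e')), pathfinish (h \<circ> \<gamma> (s e'))} = (h \<circ> p) ` e'"
    proof -
      have "h ` {pathstart (\<gamma> e), pathfinish (\<gamma> e)} = h ` p ` e" using arcs[OF e(1)] by auto
      then show ?thesis using img[OF e'] by (simp add: e_def pathstart_compose pathfinish_compose)
    qed
    show "path_image (h \<circ> \<gamma> (s e')) \<inter> (h \<circ> p) ` pverts G' \<subseteq> (h \<circ> p) ` e'"
    proof
      fix y assume "y \<in> path_image (h \<circ> \<gamma> (s e')) \<inter> (h \<circ> p) ` pverts G'"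
      then have "y \<in> h ` path_image (\<gamma> e)" "y \<in> (\<lambda>w. h (p w)) ` pverts G'"
        by (auto simp: path_image_compose e_def)
      then obtain z w where zw: "y = h z" "z \<in> path_image (\<gamma> e)" "w \<in> pverts G'" "y = h (p w)"
        by (elim imageE)
      then have "w \<in> pverts G" by (simp add: V')
      have "z \<in> p ` e"
      proof (cases "h z = 0")
        case True then show ?thesis using h_0 e zw by blast
      next
        case False
        then have "z = p w" using h_inj zw by auto
        then show ?thesis using verts[OF e(1)] zw \<open>w \<in> pverts G\<close> by blast
      qed
      then show "y \<in> (h \<circ> p) ` e'" using img[OF e'] zw by (auto simp: e_def)
    qed
    fix f' assume f': "f' \<in> edges G'" "e' \<noteq> f'"
    define f where "f = s f'"
    have f: "f \<in> edges G" "f \<noteq> e0" "e \<noteq> f"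
      using s f' e' unfolding f_def e_def by metis+
    show "path_image (h \<circ> \<gamma> (s e')) \<inter> path_image (h \<circ> \<gamma> (s f')) \<subseteq> (h \<circ> p) ` (e' \<inter> f')"
    proof
      fix y assume "y \<in> path_image (h \<circ> \<gamma> (s e')) \<inter> path_image (h \<circ> \<gamma> (s f'))"
      then have "y \<in> h ` path_image (\<gamma> e)" "y \<in> h ` path_image (\<gamma> f)"
        by (auto simp: path_image_compose e_def f_def)
      then obtain z x where zx: "y = h z" "z \<in> path_image (\<gamma> e)" "x \<in> path_image (\<gamma> f)" "y = h x"
        by (elim imageE)
      show "y \<in> (h \<circ> p) ` (e' \<inter> f')"
      \<comment> \<open>At 0 both arcs meet the collapsed edge, so both new edges contain the merged
        vertex \<open>u\<close>.\<close>
      proof (cases "y = 0")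
        case True
        then obtain w w' where "w \<in> e \<inter> e0" "w' \<in> f \<inter> e0"
          using h_0[of e z] h_0[of f x] e f zx by auto
        then have "u \<in> e' \<inter> f'" using u_in e' f' by (auto simp: e_def f_def)
        then show ?thesis using True hp[of u] uv by (auto simp: e0_def intro!: image_eqI[of _ _ u])
      next
        case False
        then have "z = x" using h_inj zx by auto
        then obtain w where w: "w \<in> e" "w \<in> f" "z = p w" using cross[OF e(1) f(1) f(3)] zx by blast
        then have "c w \<in> e' \<inter> f'" using s(2) e' f' by (auto simp: e_def f_def)
        moreover have "h (p (c w)) = y" using hc w zx by simp
        ultimately show ?thesis by force
      qed
    qed
  qed
  then show ?thesis unfolding G'_def planar_def by blast
qed

text \<open>\<open>H\<close> is a minor of \<open>G\<close> whose branch sets are the fibres of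
  \<open>f\<close>. While two vertices of \<open>U\<close> share a fibre, an edge inside it is
  contracted; once \<open>f\<close> is injective on \<open>U\<close>, its inverse embeds
  \<open>H\<close> in \<open>G\<close> and the drawing restricts.\<close>

lemma planar_minor:
  fixes G :: "'a pair_pre_digraph" and H :: "'b pair_pre_digraph"
  assumes "pair_graph G" "planar G" "U \<subseteq> pverts G" "f ` U = pverts H" "irrefl (parcs H)"
    and "\<And>w. w \<in> pverts H \<Longrightarrow> linked (parcs G) {u \<in> U. f u = w}"
    and "\<And>a b. (a, b) \<in> parcs H \<Longrightarrow> \<exists>u \<in> U. \<exists>v \<in> U. f u = a \<and> f v = b \<and> (u, v) \<in> parcs G"
  shows "planar H"
  using assms
proof (induction "card U" arbitrary: G U rule: less_induct)
  case less
  show ?case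
  proof (cases "inj_on f U")
    case True
    obtain p \<gamma> where D: "plane_drawing G p \<gamma>" using less.prems(2) by (auto simp: planar_def)
    define g where "g = inv_into U f"
    have gf: "g (f x) = x" if "x \<in> U" for x using True that by (simp add: g_def)
    have g_inj: "inj_on g (pverts H)"
    proof (rule inj_onI)
      fix x y assume "x \<in> pverts H" "y \<in> pverts H" "g x = g y"
      moreover from this obtain u v where "u \<in> U" "v \<in> U" "x = f u" "y = f v"
        unfolding less.prems(4)[symmetric] by blast
      ultimately show "x = y" using gf by metis
    qed
    have gV: "g ` pverts H \<subseteq> pverts G"
      using gf less.prems(3,4) by force
    have edge_sub: "e \<subseteq> pverts H" if "e \<in> edges H" for e
      using that less.prems(4,7) by (fastforce simp: edges_def)
    have edge: "g ` e \<in> edges G" if e: "e \<in> edges H" for e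
    proof -
      obtain a b where ab: "e = {a, b}" "(a, b) \<in> parcs H" using e by (auto simp: edges_def)
      then obtain u v where "u \<in> U" "v \<in> U" "f u = a" "f v = b" "(u, v) \<in> parcs G"
        using less.prems(7) by blast
      then have "g ` e = {u, v}" using ab gf by auto
      then show ?thesis using \<open>(u, v) \<in> parcs G\<close> by (auto simp: edges_def)
    qed
    have "plane_drawing H (p \<circ> g) (\<lambda>e. \<gamma> (g ` e))"
      unfolding plane_drawing_def
    proof (intro conjI ballI impI)
      show "inj_on (p \<circ> g) (pverts H)"
        using D g_inj gV by (auto simp: plane_drawing_def intro: comp_inj_on inj_on_subset)
    next
      fix e assume e: "e \<in> edges H"
      show "Path_Connected.arc (\<gamma> (g ` e))"
        "{pathstart (\<gamma> (g ` e)), pathfinish (\<gamma> (g ` e))} = (p \<circ> g) ` e"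
        using D edge[OF e] by (auto simp: plane_drawing_def image_comp)
      have "path_image (\<gamma> (g ` e)) \<inter> p ` pverts G \<subseteq> p ` g ` e"
        using D edge[OF e] by (auto simp: plane_drawing_def)
      then show "path_image (\<gamma> (g ` e)) \<inter> (p \<circ> g) ` pverts H \<subseteq> (p \<circ> g) ` e"
        using gV unfolding image_comp[symmetric] by blast
      fix e' assume e': "e' \<in> edges H" "e \<noteq> e'"
      then have "g ` e \<noteq> g ` e'"
        using inj_on_image_eq_iff[OF g_inj] edge_sub e by blast
      then have "path_image (\<gamma> (g ` e)) \<inter> path_image (\<gamma> (g ` e')) \<subseteq> p ` (g ` e \<inter> g ` e')"
        using D edge e e' by (auto simp: plane_drawing_def)
      also have "g ` e \<inter> g ` e' = g ` (e \<inter> e')"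
        using inj_on_image_Int[OF g_inj] edge_sub e e' by blast
      finally show "path_image (\<gamma> (g ` e)) \<inter> path_image (\<gamma> (g ` e')) \<subseteq> (p \<circ> g) ` (e \<inter> e')"
        by (simp add: image_comp)
    qed
    then show ?thesis by (auto simp: planar_def)
  next
    case False
    then obtain u v0 where "u \<in> U" "v0 \<in> U" "u \<noteq> v0" "f u = f v0" by (auto simp: inj_on_def)
    then obtain v where v: "v \<in> U" "f v = f u" "v \<noteq> u" "(u, v) \<in> parcs G"
    proof -
      have "linked (parcs G) {x \<in> U. f x = f u}"
        using less.prems(4) \<open>u \<in> U\<close> by (intro less.prems(6)) auto
      moreover have "v0 \<in> {x \<in> U. f x = f u} - {u}"
        using \<open>v0 \<in> U\<close> \<open>u \<noteq> v0\<close> \<open>f u = f v0\<close> by auto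
      ultimately obtain a b where "a \<in> {u}" "b \<in> {x \<in> U. f x = f u} - {u}" "(a, b) \<in> parcs G"
        using linkedD[of "parcs G" "{x \<in> U. f x = f u}" "{u}"] \<open>u \<in> U\<close> by blast
      then show ?thesis using that by auto
    qed
    define c where "c = id(v := u)"
    define G' where "G' = contract u v G"
    have E': "parcs G' = map_prod c c ` parcs G - Id" and V': "pverts G' = pverts G - {v}"
      by (simp_all add: G'_def contract_def c_def)
    have fc: "f (c x) = f x" for x using v by (simp add: c_def)
    have cU: "c ` U = U - {v}" using v \<open>u \<in> U\<close> by (auto simp: c_def)
    have fin: "finite U" using less.prems(1,3) finite_subset by (auto simp: pair_graph_iff)
    show ?thesis
    proof (rule less.hyps)
      show "card (U - {v}) < card U" using fin v by (meson card_Diff1_less)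
      show "pair_graph G'" "planar G'"
        using pair_graph_contract planar_contract less.prems v by (auto simp: G'_def)
      show "U - {v} \<subseteq> pverts G'" using less.prems V' by auto
      show "f ` (U - {v}) = pverts H"
        using less.prems(4) fc by (auto simp: cU[symmetric] image_comp)
      show "irrefl (parcs H)" by (rule less.prems)
    next
      fix w assume "w \<in> pverts H"
      moreover have "{x \<in> U - {v}. f x = w} = c ` {x \<in> U. f x = w}"
        using fc by (auto simp: cU[symmetric])
      ultimately show "linked (parcs G') {x \<in> U - {v}. f x = w}"
        using linked_image less.prems(6) by (metis E')
    next
      fix a b assume ab: "(a, b) \<in> parcs H"
      then obtain x y where xy: "x \<in> U" "y \<in> U" "f x = a" "f y = b" "(x, y) \<in> parcs G"
        using less.prems(7) by blast
      have "a \<noteq> b" using ab less.prems(5) by (auto simp: irrefl_def)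
      then have "c x \<noteq> c y" using fc xy by metis
      then have "(c x, c y) \<in> parcs G'" using xy by (auto simp: E' intro: rev_image_eqI)
      then show "\<exists>x \<in> U - {v}. \<exists>y \<in> U - {v}. f x = a \<and> f y = b \<and> (x, y) \<in> parcs G'"
        unfolding cU[symmetric] using xy fc by blast
    qed
  qed
qed

text \<open>Minimality is tested only against graphs on natural numbers, so \<open>H\<close> is
  copied along an injection into \<open>nat\<close>. The copy is planar as a minor with singleton
  branch sets.\<close>

lemma minimal_planar_cover_le:
  assumes "minimal_planar_cover G K" "planar_cover H K"
  shows "card (pverts G) \<le> card (pverts H)"
proof -
  obtain \<pi> where H: "pair_graph H" "planar H" "covering_projection \<pi> H K"
    using assms(2) by (auto simp: planar_cover_def)
  then have V: "finite (pverts H)" "parcs H \<subseteq> pverts H \<times> pverts H" by (auto simp: pair_graph_iff)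
  obtain f :: "'c \<Rightarrow> nat" where f: "inj_on f (pverts H)"
    using finite_imp_inj_to_nat_seg[OF V(1)] by auto
  define g where "g = inv_into (pverts H) f"
  have gf: "g (f x) = x" if "x \<in> pverts H" for x using f that by (simp add: g_def)
  define H' where "H' = \<lparr>pverts = f ` pverts H, parcs = map_prod f f ` parcs H\<rparr>"
  have f_eq: "f x = f y \<longleftrightarrow> x = y" if "x \<in> pverts H" "y \<in> pverts H" for x y
    using that f by (auto simp: inj_on_def)
  have "pair_graph H'"
    using H(1) V unfolding pair_graph_iff H'_def
    by (fastforce simp: irrefl_def sym_def f_eq)
  moreover have "planar H'"
  proof (rule planar_minor[OF H(1,2) order_refl])
    show "f ` pverts H = pverts H'" by (simp add: H'_def)
    show "irrefl (parcs H')" using \<open>pair_graph H'\<close> by (simp add: pair_graph_iff)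
    fix w assume "w \<in> pverts H'"
    then obtain x where "x \<in> pverts H" "w = f x" by (auto simp: H'_def)
    then have "{u \<in> pverts H. f u = w} = {x}" using f_eq by auto
    then show "linked (parcs H) {u \<in> pverts H. f u = w}" by (simp add: linked_singleton)
  qed (use V in \<open>fastforce simp: H'_def\<close>)
  moreover have "covering_projection (\<pi> \<circ> g) H' K"
    unfolding covering_projection_def
  proof (intro conjI ballI)
    show "(\<pi> \<circ> g) ` pverts H' = pverts K"
      using H(3) gf by (force simp: covering_projection_def H'_def image_comp)
    fix w assume "w \<in> pverts H'"
    then obtain x where x: "x \<in> pverts H" "w = f x" by (auto simp: H'_def)
    have nb: "parcs H' `` {w} = f ` (parcs H `` {x})"
    proof (intro equalityI subsetI)
      fix z assume "z \<in> parcs H' `` {w}"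
      then obtain y y' where "(y, y') \<in> parcs H" "f y = f x" "z = f y'" using x by (auto simp: H'_def)
      moreover from this have "y = x" using f_eq x V(2) by blast
      ultimately show "z \<in> f ` (parcs H `` {x})" by blast
    next
      fix z assume "z \<in> f ` (parcs H `` {x})"
      then show "z \<in> parcs H' `` {w}" using x by (force simp: H'_def)
    qed
    have "bij_betw g (parcs H' `` {w}) (parcs H `` {x})"
      unfolding nb using gf V(2) by (intro bij_betw_byWitness[of _ f]) auto
    moreover have "bij_betw \<pi> (parcs H `` {x}) (parcs K `` {\<pi> x})"
      using H(3) x by (auto simp: covering_projection_def)
    ultimately show "bij_betw (\<pi> \<circ> g) (parcs H' `` {w}) (parcs K `` {(\<pi> \<circ> g) w})"
      using bij_betw_trans gf x by fastforce
  qed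
  ultimately have "planar_cover H' K" by (auto simp: planar_cover_def)
  then have "card (pverts G) \<le> card (pverts H')"
    using assms(1) by (auto simp: minimal_planar_cover_def)
  also have "\<dots> \<le> card (pverts H)" using V by (simp add: H'_def card_image_le)
  finally show ?thesis .
qed

section \<open>Splitting a connected set\<close>

lemma linked_Un_adjacent:
  assumes "linked E D" "sym E" "\<And>x. x \<in> S \<Longrightarrow> \<exists>d \<in> D. (x, d) \<in> E"
  shows "linked E (D \<union> S)"
  unfolding linked_def
proof (intro allI impI)
  fix T assume T: "T \<subseteq> D \<union> S" "T \<noteq> {}" "T \<noteq> D \<union> S"
  consider "T \<inter> D = {}" | "D \<subseteq> T" | "T \<inter> D \<noteq> {}" "T \<inter> D \<noteq> D" by blast
  then show "\<exists>a\<in>T. \<exists>b\<in>D \<union> S - T. (a, b) \<in> E"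
  proof cases
    case 1
    then show ?thesis using T assms(3) by blast
  next
    case 2
    then obtain x where "x \<in> S" "x \<notin> T" using T by blast
    then show ?thesis using assms(2,3) 2 by (blast dest: symD)
  next
    case 3
    then show ?thesis using linkedD[OF assms(1), of "T \<inter> D"] by blast
  qed
qed

lemma other_element_if_card_ge_2:
  assumes "2 \<le> card N"
  obtains y where "y \<in> N" "y \<noteq> u"
proof -
  have "\<not> N \<subseteq> {u}" using assms card_mono[of "{u}" N] by auto
  then show ?thesis using that by blast
qed

text \<open>
  Among the vertices of \<open>F2\<close> adjacent to \<open>F1\<close>, one that leaves the largest component around \<open>x2\<close>
  leaves nothing else: by the expansion hypothesis, any other component would contain a better one.
\<close>

lemma peel_vertex:
  assumes E: "sym E" and "finite Q" "x2 \<notin> Q"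
    and expand: "\<And>S. S \<subseteq> Q \<Longrightarrow> S \<noteq> {} \<Longrightarrow> 2 \<le> card (E `` S \<inter> (F1 \<union> F2) - S)"
    and F: "F1 \<inter> F2 = {}" "F2 - {x2} \<subseteq> Q" "x2 \<in> F2" "linked E F2" "q \<in> F2" "q \<noteq> x2"
  obtains a u where "a \<in> F1" "u \<in> F2 - {x2}" "(a, u) \<in> E" "linked E (F2 - {u})"
proof -
  have fin: "finite F2" using assms(2) F(2) by (meson finite.emptyI finite.insertI finite_Diff2 finite_subset)
  define adj where "adj u \<longleftrightarrow> u \<in> F2 - {x2} \<and> (\<exists>a\<in>F1. (a, u) \<in> E)" for u
  have "\<exists>D. x2 \<in> D \<and> D \<subseteq> F2 - {u} \<and> linked E D \<and> (\<forall>d\<in>D. \<forall>s\<in>F2 - {u} - D. (d, s) \<notin> E)"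
    if "u \<in> F2 - {x2}" for u
  proof -
    have "finite (F2 - {u})" "x2 \<in> F2 - {u}" using that F fin by auto
    then show ?thesis using component_exists[of "F2 - {u}" x2 E] E by metis
  qed
  then obtain D where D: "\<And>u. u \<in> F2 - {x2} \<Longrightarrow> x2 \<in> D u \<and> D u \<subseteq> F2 - {u} \<and> linked E (D u) \<and>
      (\<forall>d\<in>D u. \<forall>s\<in>F2 - {u} - D u. (d, s) \<notin> E)" by metis
  \<comment> \<open>Of two outer neighbours at most one is \<open>x2\<close>; the other lies in
    \<open>F1\<close>, so there is a candidate \<open>u0\<close>.\<close>
  obtain y where y: "y \<in> E `` (F2 - {x2}) \<inter> (F1 \<union> F2) - (F2 - {x2})" "y \<noteq> x2"
    using expand[of "F2 - {x2}"] F other_element_if_card_ge_2 by (metis empty_iff insert_Diff_single insert_iff)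
  then obtain u0 where "adj u0" using E by (auto simp: adj_def dest: symD)
  moreover have "card (D u) < Suc (card F2)" if "adj u" for u
    using D[of u] that fin by (auto simp: adj_def less_Suc_eq_le intro: card_mono)
  ultimately have "\<exists>u. adj u \<and> (\<forall>w. adj w \<longrightarrow> card (D w) \<le> card (D u))"
    by (intro ex_has_greatest_nat[of adj u0 _ "Suc (card F2)"]) auto
  then obtain u where u: "adj u" "\<And>w. adj w \<Longrightarrow> card (D w) \<le> card (D u)" by blast
  then have uF: "u \<in> F2 - {x2}" by (simp add: adj_def)
  note Du = D[OF uF]
  have "F2 - {u} - D u = {}"
  proof (rule ccontr)
    define W where "W = F2 - {u} - D u"
    assume "F2 - {u} - D u \<noteq> {}"
    then have W: "W \<noteq> {}" "W \<subseteq> Q" using Du F by (auto simp: W_def)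
    \<comment> \<open>A neighbour of \<open>W\<close> outside \<open>W\<close> and other than
      \<open>u\<close> cannot lie in the component \<open>D u\<close>, so it lies in
      \<open>F1\<close> and makes some \<open>w\<close> in \<open>W\<close> a candidate.\<close>
    obtain y where y: "y \<in> E `` W \<inter> (F1 \<union> F2) - W" "y \<noteq> u"
      using expand[OF W(2,1)] by (rule other_element_if_card_ge_2)
    then obtain w where w: "w \<in> W" "(w, y) \<in> E" "(y, w) \<in> E" using E by (auto dest: symD)
    have "y \<notin> D u" using Du w unfolding W_def by blast
    then have "y \<in> F1" using y by (auto simp: W_def)
    then have adj_w: "adj w" using w Du by (auto simp: adj_def W_def)
    then have wF: "w \<in> F2 - {x2}" by (simp add: adj_def)
    obtain a b where ab: "a \<in> D u" "b \<in> F2 - D u" "(a, b) \<in> E"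
      using linkedD[OF F(4), of "D u"] Du uF by blast
    then have "b = u" using Du by blast
    then have lnk: "linked E (insert u (D u))" using Du ab E linked_insert by metis
    \<comment> \<open>This connected set contains \<open>x2\<close> and avoids \<open>w\<close>.
      Hence the component for \<open>w\<close> is larger than \<open>D u\<close>, against the choice
      of \<open>u\<close>.\<close>
    have "insert u (D u) \<subseteq> D w"
    proof (rule ccontr)
      assume not_sub: "\<not> insert u (D u) \<subseteq> D w"
      define Z where "Z = D w \<inter> insert u (D u)"
      have "Z \<noteq> insert u (D u)" using not_sub by (auto simp: Z_def)
      moreover have "x2 \<in> Z" using D[OF wF] Du by (auto simp: Z_def)
      then have "Z \<noteq> {}" by auto
      moreover have "Z \<subseteq> insert u (D u)" by (auto simp: Z_def)
      ultimately obtain a b where "a \<in> Z" "b \<in> insert u (D u) - Z" "(a, b) \<in> E"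
        using linkedD[OF lnk] by metis
      then have "a \<in> D w" "b \<in> insert u (D u) - D w" "(a, b) \<in> E" by (auto simp: Z_def)
      moreover from this have "b \<in> F2 - {w} - D w" using Du uF w(1) unfolding W_def by blast
      ultimately show False using D[OF wF] by blast
    qed
    moreover have "D w \<subseteq> F2" "D u \<subseteq> F2" "u \<notin> D u" using D[OF wF] Du by auto
    moreover from this have "finite (D w)" "finite (D u)" using fin finite_subset by auto
    ultimately have "card (D u) < card (D w)"
      by (metis card_insert_disjoint card_mono less_eq_Suc_le)
    then show False using u(2)[OF adj_w] by simp
  qed
  then have "D u = F2 - {u}" using Du by blast
  then show ?thesis using that u(1) Du by (auto simp: adj_def)
qed

text \<open>Starting from \<open>{x1}\<close> and \<open>insert x2 Q\<close>, vertices are moved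
  across one at a time by \<open>peel_vertex\<close>, which keeps both sides linked. The process
  stops when the first of \<open>q\<close> and \<open>q'\<close> has crossed.\<close>

lemma split_linked:
  assumes E: "sym E" and Q: "finite Q" "linked E Q" "x1 \<noteq> x2" "x1 \<notin> Q" "x2 \<notin> Q"
    and expand: "\<And>S. S \<subseteq> Q \<Longrightarrow> S \<noteq> {} \<Longrightarrow> 2 \<le> card (E `` S \<inter> (Q \<union> {x1, x2}) - S)"
    and q: "q \<in> Q" "q' \<in> Q" "q \<noteq> q'"
  shows "\<exists>F1 F2. F1 \<union> F2 = Q \<union> {x1, x2} \<and> F1 \<inter> F2 = {} \<and> x1 \<in> F1 \<and> x2 \<in> F2 \<and>
    linked E F1 \<and> linked E F2 \<and> (q \<in> F1 \<and> q' \<in> F2 \<or> q' \<in> F1 \<and> q \<in> F2)"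
proof -
  have step: ?thesis
    if "F1 \<union> F2 = Q \<union> {x1, x2}" "F1 \<inter> F2 = {}" "x1 \<in> F1" "x2 \<in> F2" "linked E F1" "linked E F2"
      "q \<in> F2" "q' \<in> F2" for F1 F2
    using that
  proof (induction "card F2" arbitrary: F1 F2 rule: less_induct)
    case less
    have "2 \<le> card (E `` S \<inter> (F1 \<union> F2) - S)" if "S \<subseteq> Q" "S \<noteq> {}" for S
      using expand that less.prems(1) by simp
    moreover have "F2 - {x2} \<subseteq> Q" "q \<noteq> x2" using less.prems q Q by auto
    ultimately obtain a u where u: "a \<in> F1" "u \<in> F2 - {x2}" "(a, u) \<in> E" "linked E (F2 - {u})"
      using peel_vertex[OF E Q(1) Q(5)] less.prems by metis
    have ins: "linked E (insert u F1)" using u less.prems linked_insert E by metis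
    have part: "insert u F1 \<union> (F2 - {u}) = Q \<union> {x1, x2}" "insert u F1 \<inter> (F2 - {u}) = {}"
      "x1 \<in> insert u F1" "x2 \<in> F2 - {u}" using less.prems u by auto
    have "finite F2" using Q(1) less.prems(1) by (metis finite.emptyI finite.insertI finite_Un)
    then have smaller: "card (F2 - {u}) < card F2" using u by (meson DiffD1 card_Diff1_less)
    show ?case
    proof (cases "u = q \<or> u = q'")
      case True
      then have "q \<in> insert u F1 \<and> q' \<in> F2 - {u} \<or> q' \<in> insert u F1 \<and> q \<in> F2 - {u}"
        using less.prems q by auto
      then show ?thesis using part ins u(4) by blast
    next
      case False
      then show ?thesis using less.hyps[OF smaller part ins u(4)] less.prems by auto
    qed
  qed
  \<comment> \<open>Expansion for \<open>Q\<close> itself shows that \<open>x2\<close> is adjacent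
    to \<open>Q\<close>, so the starting sets are linked.\<close>
  have "E `` Q \<inter> (Q \<union> {x1, x2}) - Q \<subseteq> {x1, x2}" by auto
  moreover obtain y where "y \<in> E `` Q \<inter> (Q \<union> {x1, x2}) - Q" "y \<noteq> x1"
    using expand[of Q] q other_element_if_card_ge_2 by (metis empty_iff order_refl)
  ultimately have "y = x2" by auto
  then have "x2 \<in> E `` Q" using \<open>y \<in> _\<close> by auto
  then have "linked E (insert x2 Q)" using linked_insert[OF Q(2) E] by blast
  moreover have "x1 \<notin> insert x2 Q" using Q by auto
  ultimately show ?thesis
    using step[of "{x1}" "insert x2 Q"] linked_singleton[of E x1] q by auto
qed

section \<open>Counting lifts on the sides of a smallest cut\<close>

text \<open>The sides need not be connected and \<open>X\<close> may be empty, so a disconnected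
  graph is no special case.\<close>

definition separates :: "'a set \<Rightarrow> ('a \<times> 'a) set \<Rightarrow> 'a set \<Rightarrow> 'a set \<Rightarrow> 'a set \<Rightarrow> bool" where
  "separates V E X A B \<longleftrightarrow> V = X \<union> A \<union> B \<and> X \<inter> A = {} \<and> X \<inter> B = {} \<and> A \<inter> B = {} \<and>
     A \<noteq> {} \<and> B \<noteq> {} \<and> E \<inter> (A \<times> B) = {}"

locale cover =
  fixes V :: "'a set" and E :: "('a \<times> 'a) set" and W :: "'b set" and F :: "('b \<times> 'b) set"
    and \<pi> :: "'a \<Rightarrow> 'b"
  assumes fin: "finite V" and E_sub: "E \<subseteq> V \<times> V" and E_sym: "sym E" and E_irrefl: "irrefl E"
    and F_sub: "F \<subseteq> W \<times> W" and F_sym: "sym F" and F_irrefl: "irrefl F"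
    and onto: "\<pi> ` V = W"
    and bij: "\<And>v. v \<in> V \<Longrightarrow> bij_betw \<pi> (E `` {v}) (F `` {\<pi> v})"
begin

lemma lift_exists: "v \<in> V \<Longrightarrow> (\<pi> v, y) \<in> F \<Longrightarrow> \<exists>w. (v, w) \<in> E \<and> \<pi> w = y"
  using bij[of v] unfolding bij_betw_def by (metis Image_singleton_iff imageE)

lemma lift_unique: "(v, w) \<in> E \<Longrightarrow> (v, w') \<in> E \<Longrightarrow> \<pi> w = \<pi> w' \<Longrightarrow> w = w'"
  using bij[of v] E_sub unfolding bij_betw_def inj_on_def by blast

lemma proj_edge: "(v, w) \<in> E \<Longrightarrow> (\<pi> v, \<pi> w) \<in> F"
  using bij[of v] E_sub unfolding bij_betw_def by blast

lemma edge_sym: "(v, w) \<in> E \<Longrightarrow> (w, v) \<in> E"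
  using E_sym by (rule symD)

lemma lift_unique': "(w, v) \<in> E \<Longrightarrow> (w', v) \<in> E \<Longrightarrow> \<pi> w = \<pi> w' \<Longrightarrow> w = w'"
  by (rule lift_unique[OF edge_sym edge_sym])

lemma no_loop: "(y, y) \<notin> F"
  using F_irrefl by (simp add: irrefl_def)

end

text \<open>Since lifts in a cover are unique, the size of this set is the number of edges from
  \<open>X\<close> to \<open>S\<close> over \<open>(y, v)\<close>.\<close>

definition hits :: "('a \<times> 'a) set \<Rightarrow> ('a \<Rightarrow> 'b) \<Rightarrow> 'a set \<Rightarrow> 'a set \<Rightarrow> 'b \<Rightarrow> 'b \<Rightarrow> 'a set" where
  "hits E \<pi> X S y v = {x \<in> X. \<pi> x = y \<and> (\<exists>a \<in> S. (x, a) \<in> E \<and> \<pi> a = v)}"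

text \<open>By \<open>card_hits_eq_out\<close> below, the choice of \<open>v\<close> is immaterial.\<close>

definition out :: "('a \<times> 'a) set \<Rightarrow> ('b \<times> 'b) set \<Rightarrow> ('a \<Rightarrow> 'b) \<Rightarrow> 'a set \<Rightarrow> 'a set \<Rightarrow> 'b \<Rightarrow> nat" where
  "out E F \<pi> X S y = card (hits E \<pi> X S y (SOME v. (y, v) \<in> F \<and> v \<notin> \<pi> ` X))"

text \<open>\<open>linked_base\<close> and \<open>card_W\<close> express the 4-connectedness of the
  base graph.\<close>

locale min_separated = cover +
  fixes X A B
  assumes sep: "separates V E X A B"
    and minimal: "\<And>X' A' B'. separates V E X' A' B' \<Longrightarrow> card X \<le> card X'"
    and card_X: "card X \<le> 3"
    and linked_base: "\<And>Y. Y \<subseteq> W \<Longrightarrow> card Y \<le> 3 \<Longrightarrow> linked F (W - Y)"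
    and card_W: "card W > 4"
begin

abbreviation "Y \<equiv> \<pi> ` X"
abbreviation "fib y \<equiv> {x \<in> X. \<pi> x = y}"
abbreviation "T \<equiv> hits E \<pi> X"
abbreviation "d \<equiv> out E F \<pi> X"

lemma parts: "V = X \<union> A \<union> B" "X \<inter> A = {}" "X \<inter> B = {}" "A \<inter> B = {}" "A \<noteq> {}" "B \<noteq> {}"
    "\<And>a b. a \<in> A \<Longrightarrow> b \<in> B \<Longrightarrow> (a, b) \<notin> E"
  using sep unfolding separates_def by blast+

lemma fin_parts: "finite X" "finite A" "finite B"
  using fin parts(1) by auto

text \<open>The hypotheses are symmetric in the two sides, so every result about \<open>A\<close>
  can be reused for \<open>B\<close>.\<close>

lemma swap: "min_separated V E W F \<pi> X B A"
proof
  show "separates V E X B A"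
    unfolding separates_def using parts edge_sym by blast
qed (fact minimal card_X linked_base card_W)+

lemma side_nbr: "a \<in> A \<Longrightarrow> (a, b) \<in> E \<Longrightarrow> b \<in> A \<union> X"
  using parts E_sub by blast

text \<open>A point of \<open>X\<close> without neighbours in \<open>A\<close> could join
  \<open>B\<close>, leaving a smaller cut.\<close>

lemma touch:
  assumes "x \<in> X" shows "\<exists>a\<in>A. (x, a) \<in> E"
proof (rule ccontr)
  assume "\<not> ?thesis"
  then have "separates V E (X - {x}) A (insert x B)"
    unfolding separates_def using parts assms edge_sym by blast
  then have "card X \<le> card (X - {x})" by (rule minimal)
  then show False using assms fin_parts by (meson card_Diff1_less leD)
qed

text \<open>The lifts of the edge with at least one end in \<open>A\<close> are counted from both
  ends; by unique lifting both endpoint projections are injective.\<close>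

lemma count:
  assumes "(y, y') \<in> F"
  shows "card {a\<in>A. \<pi> a = y} + card (T A y y') = card {a\<in>A. \<pi> a = y'} + card (T A y' y)"
proof -
  define P where "P = {(p, q) \<in> E. \<pi> p = y \<and> \<pi> q = y' \<and> (p \<in> A \<and> q \<in> A \<union> X \<or> p \<in> X \<and> q \<in> A)}"
  have "(y', y) \<in> F" using assms F_sym by (rule symD[rotated])
  have Fy: "fst ` P = {a\<in>A. \<pi> a = y} \<union> T A y y'"
  proof (intro equalityI subsetI)
    fix p assume "p \<in> {a\<in>A. \<pi> a = y} \<union> T A y y'"
    then have "\<exists>q. (p, q) \<in> P"
    proof
      assume p: "p \<in> {a\<in>A. \<pi> a = y}"
      then obtain q where "(p, q) \<in> E" "\<pi> q = y'" using lift_exists[of p y'] assms parts(1) by auto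
      then show ?thesis using p side_nbr by (auto simp: P_def)
    qed (auto simp: P_def hits_def)
    then show "p \<in> fst ` P" by force
  qed (auto simp: P_def hits_def)
  have Fy': "snd ` P = {a\<in>A. \<pi> a = y'} \<union> T A y' y"
  proof (intro equalityI subsetI)
    fix q assume "q \<in> {a\<in>A. \<pi> a = y'} \<union> T A y' y"
    then have "\<exists>p. (p, q) \<in> P"
    proof
      assume q: "q \<in> {a\<in>A. \<pi> a = y'}"
      then obtain p where "(q, p) \<in> E" "\<pi> p = y"
        using lift_exists[of q y] \<open>(y', y) \<in> F\<close> parts(1) by auto
      then show ?thesis using q side_nbr[of q p] edge_sym[of q p]
        by (auto simp: P_def intro!: exI[of _ p])
    qed (auto simp: P_def hits_def dest: edge_sym)
    then show "q \<in> snd ` P" by force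
  next
    fix q assume "q \<in> snd ` P"
    then obtain p where "(p, q) \<in> P" by auto
    then show "q \<in> {a\<in>A. \<pi> a = y'} \<union> T A y' y"
      using edge_sym[of p q] by (auto simp: P_def hits_def)
  qed
  have "inj_on fst P" "inj_on snd P"
    by (auto simp: inj_on_def P_def dest: lift_unique lift_unique')
  then have "card (fst ` P) = card (snd ` P)" by (simp add: card_image)
  moreover have "card ({a\<in>A. \<pi> a = v} \<union> T A v w) = card {a\<in>A. \<pi> a = v} + card (T A v w)" for v w
    using fin_parts parts(2) by (intro card_Un_disjoint) (auto simp: hits_def)
  ultimately show ?thesis unfolding Fy Fy' by metis
qed

lemma Y_sub: "Y \<subseteq> W" and card_Y: "card Y \<le> 3"
  using onto parts(1) card_image_le[OF fin_parts(1), of \<pi>] card_X by auto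

text \<open>For an edge outside \<open>Y\<close> both correction terms of \<open>count\<close>
  vanish, so the fibre size spreads along the connected set \<open>W - Y\<close>.\<close>

lemma count_constant: "\<exists>m. \<forall>v \<in> W - Y. card {a\<in>A. \<pi> a = v} = m"
proof (cases "W - Y = {}")
  case False
  then obtain v0 where v0: "v0 \<in> W - Y" by blast
  define S where "S = {v \<in> W - Y. card {a\<in>A. \<pi> a = v} = card {a\<in>A. \<pi> a = v0}}"
  have "S = W - Y"
  proof (rule ccontr)
    assume "S \<noteq> W - Y"
    then obtain a b where ab: "a \<in> S" "b \<in> W - Y - S" "(a, b) \<in> F"
      using linkedD[OF linked_base[OF Y_sub card_Y], of S] v0 by (auto simp: S_def)
    then have "T A a b = {}" "T A b a = {}" by (auto simp: S_def hits_def)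
    then show False using count[OF ab(3)] ab by (auto simp: S_def)
  qed
  then show ?thesis by (auto simp: S_def)
qed auto

text \<open>The base stays connected without \<open>Y - {y}\<close>, and since \<open>W\<close> has
  more than four vertices, \<open>y\<close> is not alone there.\<close>

lemma outer_nbr:
  assumes "y \<in> Y" shows "\<exists>v. (y, v) \<in> F \<and> v \<notin> Y"
proof -
  have "finite Y" using fin_parts by simp
  then have "card (Y - {y}) \<le> 3" using card_Y by (meson card_Diff1_le le_trans)
  then have L: "linked F (W - (Y - {y}))" using Y_sub by (intro linked_base) auto
  have "{y} \<noteq> W - (Y - {y})"
  proof
    assume "{y} = W - (Y - {y})"
    then have "W \<subseteq> Y" using assms by auto
    then have "card W \<le> card Y" by (rule card_mono[OF \<open>finite Y\<close>])
    then show False using card_W card_Y by linarith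
  qed
  moreover have "{y} \<subseteq> W - (Y - {y})" using assms Y_sub by auto
  ultimately obtain a b where "a \<in> {y}" "b \<in> W - (Y - {y}) - {y}" "(a, b) \<in> F"
    using linkedD[OF L] by blast
  then show ?thesis by auto
qed

text \<open>No point of \<open>X\<close> lies over \<open>v\<close>, so \<open>count\<close> has
  just one correction term, and \<open>count_constant\<close> supplies the same \<open>m\<close> for
  all \<open>y\<close>.\<close>

lemma card_out: "\<exists>m. \<forall>y\<in>Y. \<forall>v. (y, v) \<in> F \<longrightarrow> v \<notin> Y \<longrightarrow> card {a\<in>A. \<pi> a = y} + card (T A y v) = m"
proof -
  obtain m where m: "\<And>v. v \<in> W - Y \<Longrightarrow> card {a\<in>A. \<pi> a = v} = m" using count_constant by blast
  have "card {a\<in>A. \<pi> a = y} + card (T A y v) = m" if "y \<in> Y" "(y, v) \<in> F" "v \<notin> Y" for y v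
  proof -
    have "T A v y = {}" "v \<in> W" using that F_sub by (auto simp: hits_def)
    then show ?thesis using count[OF that(2)] m that by simp
  qed
  then show ?thesis by (intro exI[of _ m]) simp
qed

lemma some_outer:
  assumes "y \<in> Y"
  shows "(y, SOME v. (y, v) \<in> F \<and> v \<notin> Y) \<in> F \<and> (SOME v. (y, v) \<in> F \<and> v \<notin> Y) \<notin> Y"
  using someI_ex[OF outer_nbr[OF assms]] .

lemma card_hits_eq_out:
  assumes "y \<in> Y" "(y, v) \<in> F" "v \<notin> Y" shows "card (T A y v) = d A y"
proof -
  from card_out obtain m where "\<forall>y\<in>Y. \<forall>v. (y, v) \<in> F \<longrightarrow> v \<notin> Y \<longrightarrow>
      card {a\<in>A. \<pi> a = y} + card (T A y v) = m" ..
  note m = this[rule_format, OF assms(1)]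
  have "card {a\<in>A. \<pi> a = y} + d A y = m"
    unfolding out_def using some_outer[OF assms(1)] by (intro m) auto
  then show ?thesis using m[OF assms(2,3)] by linarith
qed

text \<open>This is \<open>count\<close> for an edge inside \<open>Y\<close>, with the fibre sizes
  in \<open>A\<close> eliminated by means of \<open>card_out\<close>.\<close>

lemma out_balance:
  assumes "y \<in> Y" "y' \<in> Y" "(y, y') \<in> F"
  shows "d A y + card (T A y' y) = d A y' + card (T A y y')"
proof -
  from card_out obtain m where "\<forall>y\<in>Y. \<forall>v. (y, v) \<in> F \<longrightarrow> v \<notin> Y \<longrightarrow>
      card {a\<in>A. \<pi> a = y} + card (T A y v) = m" ..
  note m = this[rule_format]
  have "card {a\<in>A. \<pi> a = y} + d A y = m" if "y \<in> Y" for y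
    unfolding out_def using some_outer[OF that] that by (intro m) auto
  from this[OF assms(1)] this[OF assms(2)] show ?thesis using count[OF assms(3)] by linarith
qed

lemma hits_le: "card (T S y v) \<le> card (fib y)"
  using fin_parts by (intro card_mono) (auto simp: hits_def)

lemma hits_Int: "T A y v \<inter> T B y v = {}"
  using parts(4) by (auto simp: hits_def dest: lift_unique)

lemma hits_add_le: "card (T A y v) + card (T B y v) \<le> card (fib y)"
proof -
  have "card (T A y v) + card (T B y v) = card (T A y v \<union> T B y v)"
    using fin_parts hits_Int by (intro card_Un_disjoint[symmetric]) (auto simp: hits_def)
  also have "\<dots> \<le> card (fib y)" using fin_parts by (intro card_mono) (auto simp: hits_def)
  finally show ?thesis .
qed

text \<open>No point of \<open>X\<close> lies over an outer neighbour \<open>v\<close>, so each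
  point of \<open>X\<close> over \<open>y\<close> has its neighbour over \<open>v\<close> on exactly
  one side.\<close>

lemma out_add:
  assumes "y \<in> Y" shows "d A y + d B y = card (fib y)"
proof -
  obtain v where v: "(y, v) \<in> F" "v \<notin> Y" using outer_nbr assms by blast
  interpret S: min_separated V E W F \<pi> X B A by (rule swap)
  have "T A y v \<union> T B y v = fib y"
  proof (intro equalityI subsetI)
    fix x assume x: "x \<in> fib y"
    then obtain w where w: "(x, w) \<in> E" "\<pi> w = v" using lift_exists[of x v] v parts(1) by auto
    then have "w \<in> A \<union> B" using E_sub parts(1) v by blast
    then show "x \<in> T A y v \<union> T B y v" using x w by (auto simp: hits_def)
  qed (auto simp: hits_def)
  moreover have "card (T A y v \<union> T B y v) = card (T A y v) + card (T B y v)"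
    using fin_parts hits_Int by (intro card_Un_disjoint) (auto simp: hits_def)
  ultimately show ?thesis
    using card_hits_eq_out[OF assms v] S.card_hits_eq_out[OF assms v] by simp
qed

lemma hits_loop: "T S y y = {}"
  using proj_edge no_loop by (force simp: hits_def)

text \<open>With \<open>d\<close> equal to 0, no neighbour of \<open>x\<close> in \<open>A\<close>
  lies over a vertex outside \<open>Y\<close>, so the one provided by \<open>touch\<close> lies over
  \<open>Y\<close>.\<close>

lemma touch_inner:
  assumes "x \<in> X" "d A (\<pi> x) = 0"
  obtains y' where "y' \<in> Y" "(\<pi> x, y') \<in> F" "x \<in> T A (\<pi> x) y'"
proof -
  obtain a where a: "a \<in> A" "(x, a) \<in> E" using touch assms by blast
  then have e: "(\<pi> x, \<pi> a) \<in> F" by (intro proj_edge)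
  have x: "x \<in> T A (\<pi> x) (\<pi> a)" using a assms by (auto simp: hits_def)
  moreover have "finite (T A (\<pi> x) (\<pi> a))" using fin_parts by (auto simp: hits_def)
  ultimately have "card (T A (\<pi> x) (\<pi> a)) \<noteq> 0" by auto
  then have "\<pi> a \<in> Y" using card_hits_eq_out[OF _ e] assms by (metis imageI)
  then show ?thesis using that e x by blast
qed

end

text \<open>The condition under which one vertex per point of \<open>Y\<close> can take the place of
  \<open>X\<close>: outer neighbours are met exactly once, inner ones at most once.\<close>

definition good_side :: "('a \<times> 'a) set \<Rightarrow> ('b \<times> 'b) set \<Rightarrow> ('a \<Rightarrow> 'b) \<Rightarrow> 'a set \<Rightarrow> 'a set \<Rightarrow> bool" where
  "good_side E F \<pi> X S \<longleftrightarrow>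
     (\<forall>y \<in> \<pi> ` X. out E F \<pi> X S y = 1 \<and> (\<forall>y' \<in> \<pi> ` X. card (hits E \<pi> X S y y') \<le> 1))"

section \<open>Existence of a good side\<close>

context min_separated
begin

lemma card_fib_pos: "y \<in> Y \<Longrightarrow> card (fib y) \<ge> 1"
  using fin_parts(1) by (force simp: Suc_le_eq card_gt_0_iff)

lemma fib_inj:
  assumes "inj_on \<pi> X" "x \<in> X" shows "fib (\<pi> x) = {x}"
  using assms by (auto simp: inj_on_def)

lemma card_fib_inj:
  assumes "inj_on \<pi> X" "y \<in> Y" shows "card (fib y) = 1"
proof -
  obtain x where "x \<in> X" "y = \<pi> x" using assms(2) by auto
  then show ?thesis using fib_inj[OF assms(1)] by simp
qed

lemma card_hits_pos:
  assumes "x \<in> T S y v" shows "card (T S y v) \<ge> 1"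
proof -
  have "finite (T S y v)" using fin_parts(1) by (simp add: hits_def)
  then show ?thesis using assms by (auto simp: Suc_le_eq card_gt_0_iff)
qed

text \<open>The fibre is a single point and \<open>d B y = 0\<close>, so this point reaches
  \<open>B\<close> only over some \<open>y'\<close> in \<open>Y\<close>. The balance for
  \<open>B\<close> then forces \<open>d B y' = 0\<close>.\<close>

lemma partner:
  assumes inj: "inj_on \<pi> X" and y: "y \<in> Y" "d A y = 1"
  obtains y' where "y' \<in> Y" "y' \<noteq> y" "d A y' = 1"
proof -
  interpret S: min_separated V E W F \<pi> X B A by (rule swap)
  have B0: "d B y = 0" using out_add[OF y(1)] card_fib_inj[OF inj y(1)] y(2) by linarith
  obtain x where x: "x \<in> X" "\<pi> x = y" using y by auto
  obtain y' where y': "y' \<in> Y" "(y, y') \<in> F" "x \<in> T B y y'"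
    using S.touch_inner[OF x(1)] B0 unfolding x(2) by blast
  have "card (T B y' y) \<le> 1" using hits_le card_fib_inj[OF inj y'(1)] by metis
  then have "d B y' = 0"
    using S.out_balance[OF y(1) y'(1,2)] card_hits_pos[OF y'(3)] B0 by linarith
  then have "d A y' = 1" using out_add[OF y'(1)] card_fib_inj[OF inj y'(1)] by linarith
  moreover have "y' \<noteq> y" using y' no_loop by auto
  ultimately show ?thesis using that y'(1) by blast
qed

text \<open>On \<open>Y\<close> the values of \<open>d A\<close> and \<open>d B\<close> add up to 1.
  If neither is constantly 1, then by \<open>partner\<close> each value of \<open>d A\<close> occurs
  twice, and \<open>Y\<close> would have four elements.\<close>

lemma good_inj:
  assumes inj: "inj_on \<pi> X"
  shows "good_side E F \<pi> X A \<or> good_side E F \<pi> X B"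
proof -
  interpret S: min_separated V E W F \<pi> X B A by (rule swap)
  have sum: "d A y + d B y = 1" if "y \<in> Y" for y
    using out_add[OF that] card_fib_inj[OF inj that] by simp
  have le: "card (T S y v) \<le> 1" if "y \<in> Y" for S y v
    using hits_le card_fib_inj[OF inj that] by metis
  have "(\<forall>y\<in>Y. d A y = 1) \<or> (\<forall>y\<in>Y. d B y = 1)"
  proof (rule ccontr)
    assume "\<not> ?thesis"
    then obtain y z where yz: "y \<in> Y" "d A y \<noteq> 1" "z \<in> Y" "d B z \<noteq> 1" by auto
    then have "d B y = 1" "d A z = 1" using sum[of y] sum[of z] by linarith+
    then obtain y' z' where "y' \<in> Y" "y' \<noteq> y" "d B y' = 1" "z' \<in> Y" "z' \<noteq> z" "d A z' = 1"
      using partner[OF inj yz(3)] S.partner[OF inj yz(1)] by metis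
    moreover from this have "y \<noteq> z" "y \<noteq> z'" "y' \<noteq> z" "y' \<noteq> z'"
      using yz sum[of y] sum[of z] sum[of y'] sum[of z'] by auto
    ultimately have "card {y, y', z, z'} = 4" "{y, y', z, z'} \<subseteq> Y" using yz by auto
    then have "4 \<le> card Y" using card_mono[of Y "{y, y', z, z'}"] fin_parts by simp
    then show False using card_Y by linarith
  qed
  then show ?thesis using le unfolding good_side_def by blast
qed

text \<open>There are no edges inside \<open>Y\<close>, so \<open>touch_inner\<close> makes both
  numbers positive. Their sum is at most 3, so one of them is 1.\<close>

lemma good_single:
  assumes Y: "Y = {y}"
  shows "good_side E F \<pi> X A \<or> good_side E F \<pi> X B"
proof -
  interpret S: min_separated V E W F \<pi> X B A by (rule swap)
  have y: "y \<in> Y" using Y by simp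
  obtain x where x: "x \<in> X" "\<pi> x = y" using y by auto
  have no: False if "y' \<in> Y" "(y, y') \<in> F" for y' using that Y no_loop by simp
  have "d A y \<noteq> 0" using touch_inner[OF x(1)] no x(2) by metis
  moreover have "d B y \<noteq> 0" using S.touch_inner[OF x(1)] no x(2) by metis
  moreover have "card (fib y) \<le> card X" using fin_parts by (intro card_mono) auto
  ultimately have "d A y = 1 \<or> d B y = 1" using out_add[OF y] card_X by linarith
  then show ?thesis unfolding good_side_def Y using hits_loop by simp
qed

text \<open>As \<open>d B z = 0\<close>, the point over \<open>z\<close> reaches \<open>B\<close>
  over \<open>y\<close>, and the balance gives \<open>card (T B y z) = d B y + 1\<close>. With
  \<open>d B y = 0\<close> both points over \<open>y\<close> would reach \<open>B\<close> over
  \<open>z\<close>, a contradiction. Hence \<open>d B y = 1\<close>, and both points over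
  \<open>y\<close> are used up by \<open>B\<close>.\<close>

lemma good_two:
  assumes Y: "Y = {y, z}" "y \<noteq> z" and card: "card (fib z) = 1" "card (fib y) = 2"
    and dz: "d A z = 1"
  shows "good_side E F \<pi> X A"
proof -
  interpret S: min_separated V E W F \<pi> X B A by (rule swap)
  have yz: "y \<in> Y" "z \<in> Y" using Y by auto
  have Bz: "d B z = 0" using out_add[OF yz(2)] dz card by linarith
  obtain x where x: "x \<in> X" "\<pi> x = z" using yz by auto
  obtain y' where y': "y' \<in> Y" "(z, y') \<in> F" "x \<in> T B z y'"
    using S.touch_inner[OF x(1)] Bz unfolding x(2) by blast
  then have "y' = y" using Y no_loop by auto
  then have zy: "(z, y) \<in> F" "card (T B z y) \<ge> 1" using y' card_hits_pos by auto
  then have "card (T B z y) = 1" using hits_le[of B z y] card by linarith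
  then have bal: "card (T B y z) = d B y + 1" using S.out_balance[OF yz(2,1) zy(1)] Bz by linarith
  have By: "d B y \<noteq> 0"
  proof
    assume 0: "d B y = 0"
    have "fib y \<subseteq> T B y z"
    proof
      fix x assume x: "x \<in> fib y"
      then have x': "x \<in> X" "\<pi> x = y" by auto
      obtain w where "w \<in> Y" "(y, w) \<in> F" "x \<in> T B y w"
        using S.touch_inner[OF x'(1)] 0 unfolding x'(2) by blast
      then show "x \<in> T B y z" using Y no_loop by auto
    qed
    moreover have "finite (T B y z)" using fin_parts(1) by (simp add: hits_def)
    ultimately have "card (fib y) \<le> card (T B y z)" by (rule card_mono[rotated])
    then show False using bal 0 card by linarith
  qed
  have "card (T A y z) + card (T B y z) \<le> 2" using hits_add_le[of y z] card by simp
  then have "d B y = 1" "card (T A y z) = 0" using bal By by linarith+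
  moreover from this have "d A y = 1" using out_add[OF yz(1)] card by linarith
  moreover have "card (T A z y) \<le> 1" using hits_le[of A z y] card by simp
  ultimately show ?thesis unfolding good_side_def Y using dz hits_loop by simp
qed

text \<open>If at most three points are mapped non-injectively, there is one fibre, or there are two
  of sizes two and one.\<close>

lemma good_exists: "good_side E F \<pi> X A \<or> good_side E F \<pi> X B"
proof (cases "inj_on \<pi> X")
  case False
  interpret S: min_separated V E W F \<pi> X B A by (rule swap)
  have "card Y < card X"
    using False eq_card_imp_inj_on[OF fin_parts(1)] card_image_le[OF fin_parts(1), of \<pi>]
    by (metis le_neq_implies_less)
  moreover have "card Y \<noteq> 0" using False fin_parts(1) by auto
  ultimately consider "card Y = 1" | "card Y = 2" "card X = 3" using card_X by linarith
  then show ?thesis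
  proof cases
    case 1
    then show ?thesis using good_single by (metis card_1_singletonE)
  next
    case 2
    then obtain y z where Y: "Y = {y, z}" "y \<noteq> z" by (meson card_2_iff)
    have wlog: ?thesis if "Y = {y, z}" "y \<noteq> z" "card (fib z) = 1" "card (fib y) = 2" for y z
    proof -
      have "d A z + d B z = 1" using out_add[of z] that by simp
      then have "d A z = 1 \<or> d B z = 1" by linarith
      then show ?thesis using good_two[OF that] S.good_two[OF that] by blast
    qed
    have "X = fib y \<union> fib z" using Y by auto
    moreover have "card (fib y \<union> fib z) = card (fib y) + card (fib z)"
      using Y fin_parts by (intro card_Un_disjoint) auto
    ultimately have "card (fib y) + card (fib z) = 3" using 2 by simp
    moreover have "card (fib y) \<ge> 1" "card (fib z) \<ge> 1" using card_fib_pos Y by auto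
    ultimately consider "card (fib y) = 2" "card (fib z) = 1" | "card (fib z) = 2" "card (fib y) = 1"
      by linarith
    then show ?thesis
      by cases (use wlog[of y z] wlog[of z y] Y in auto)
  qed
qed (rule good_inj)

section \<open>Connected pieces inside a side\<close>

text \<open>\<open>X\<close> also separates a component of \<open>B\<close> from all the rest, so
  \<open>touch\<close> applies to the component itself.\<close>

lemma touching_component:
  assumes "b \<in> B"
  obtains D where "b \<in> D" "D \<subseteq> B" "linked E D" "\<And>e s. e \<in> D \<Longrightarrow> s \<in> B - D \<Longrightarrow> (e, s) \<notin> E"
    "\<And>x. x \<in> X \<Longrightarrow> \<exists>e\<in>D. (x, e) \<in> E"
proof -
  obtain D where D: "b \<in> D" "D \<subseteq> B" "linked E D" "\<And>e s. e \<in> D \<Longrightarrow> s \<in> B - D \<Longrightarrow> (e, s) \<notin> E"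
    using component_exists[OF fin_parts(3) assms E_sym] by metis
  interpret C: min_separated V E W F \<pi> X D "A \<union> (B - D)"
  proof
    have "(e, s) \<notin> E" if "e \<in> D" "s \<in> A \<union> (B - D)" for e s
      using that D(2) D(4)[of e s] parts(7)[of s e] edge_sym[of e s] by blast
    then show "separates V E X D (A \<union> (B - D))"
      unfolding separates_def using parts(1-6) D(1,2) by blast
  qed (fact minimal card_X linked_base card_W)+
  show ?thesis using that[OF D] C.touch by blast
qed

text \<open>The outer boundary of \<open>S\<close> is again a cut, with \<open>A\<close> remaining
  on the far side.\<close>

lemma expansion:
  assumes "S \<subseteq> B" "S \<noteq> {}"
  shows "card X \<le> card (E `` S - S)"
proof (rule minimal)
  interpret S: min_separated V E W F \<pi> X B A by (rule swap)
  have "E `` S \<subseteq> B \<union> X" using S.side_nbr assms(1) by blast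
  then have "E `` S \<inter> A = {}" using parts(2,4) by blast
  moreover have "S \<inter> A = {}" using assms(1) parts(4) by blast
  ultimately have "A \<subseteq> V - S - E `` S" using parts(1) by blast
  then have "V - S - E `` S \<noteq> {}" using parts(5) by blast
  moreover have "E `` S \<subseteq> V" "S \<subseteq> V" using E_sub assms(1) parts(1) by auto
  moreover have "E \<inter> ((V - S - E `` S) \<times> S) = {}" using edge_sym by blast
  ultimately show "separates V E (E `` S - S) (V - S - E `` S) S"
    unfolding separates_def using assms(2) by blast
qed

text \<open>
  Contracting \<open>F1\<close> and \<open>F2\<close> turns this into a triangle on \<open>X\<close>. The sets come from a bipartition
  of \<open>B\<close> that separates \<open>q\<close> from \<open>q'\<close>; it exists since cuts of size two are excluded.
\<close>

lemma triangle:
  assumes X: "X = {x1, x2, x3}" "x1 \<noteq> x2" "x1 \<noteq> x3" "x2 \<noteq> x3"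
    and q: "q \<in> B" "q' \<in> B" "q \<noteq> q'" "(x3, q) \<in> E" "(x3, q') \<in> E"
  shows "\<exists>F1 F2. F1 \<subseteq> insert x1 B \<and> F2 \<subseteq> insert x2 B \<and> F1 \<inter> F2 = {} \<and> x1 \<in> F1 \<and> x2 \<in> F2 \<and>
    linked E F1 \<and> linked E F2 \<and> (\<exists>a\<in>F1. \<exists>b\<in>F2. (a, b) \<in> E) \<and>
    (\<exists>a\<in>F1. (x3, a) \<in> E) \<and> (\<exists>a\<in>F2. (x3, a) \<in> E)"
proof -
  have xB: "x1 \<notin> B" "x2 \<notin> B" "x3 \<notin> B" using X parts(3) by auto
  obtain D where D: "q \<in> D" "D \<subseteq> B" "linked E D" "\<And>e s. e \<in> D \<Longrightarrow> s \<in> B - D \<Longrightarrow> (e, s) \<notin> E"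
    "\<And>x. x \<in> X \<Longrightarrow> \<exists>e\<in>D. (x, e) \<in> E"
    using touching_component[OF q(1)] by metis
  show ?thesis
  proof (cases "D = B")
    \<comment> \<open>With a second component \<open>D'\<close>, take \<open>D\<close> with
      \<open>x1\<close> and \<open>D'\<close> with \<open>x2\<close>; an edge from \<open>D\<close>
      to \<open>x2\<close> joins them.\<close>
    case False
    then obtain b where b: "b \<in> B" "b \<notin> D" using D(2) by blast
    obtain D' where D': "b \<in> D'" "D' \<subseteq> B" "linked E D'" "\<And>x. x \<in> X \<Longrightarrow> \<exists>e\<in>D'. (x, e) \<in> E"
      using touching_component[OF b(1)] by metis
    have disj: "D' \<inter> D = {}"
    proof (rule ccontr)
      assume ne: "D' \<inter> D \<noteq> {}"
      have "D' \<inter> D \<noteq> D'" using b D'(1) by blast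
      with ne obtain e s where "e \<in> D' \<inter> D" "s \<in> D' - D' \<inter> D" "(e, s) \<in> E"
        using linkedD[OF D'(3), of "D' \<inter> D"] by (metis Int_lower1)
      then show False using D(4)[of e s] D'(2) by blast
    qed
    have L: "linked E (insert x S)" if "linked E S" "\<exists>e\<in>S. (x, e) \<in> E" for x S
      using that linked_insert[OF that(1) E_sym] edge_sym by blast
    have "linked E (insert x1 D)" "linked E (insert x2 D')" using L D(3,5) D'(3,4) X(1) by auto
    moreover have "insert x1 D \<inter> insert x2 D' = {}"
      using disj xB D(2) D'(2) X(2) by blast
    moreover have "\<exists>a\<in>D. (a, x2) \<in> E" using D(5)[of x2] X(1) edge_sym by blast
    moreover have "\<exists>a\<in>D. (x3, a) \<in> E" "\<exists>a\<in>D'. (x3, a) \<in> E" using D(5) D'(4) X(1) by auto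
    ultimately show ?thesis using D(2) D'(2)
      by (intro exI[of _ "insert x1 D"] exI[of _ "insert x2 D'"]) auto
  next
    case True
    \<comment> \<open>The boundary has at least three vertices and loses at most
      \<open>x3\<close>.\<close>
    have "2 \<le> card (E `` S \<inter> (B \<union> {x1, x2}) - S)" if S: "S \<subseteq> B" "S \<noteq> {}" for S
    proof -
      interpret S: min_separated V E W F \<pi> X B A by (rule swap)
      have "E `` S \<subseteq> B \<union> X" using S.side_nbr S(1) by blast
      then have sub: "E `` S - S - {x3} \<subseteq> E `` S \<inter> (B \<union> {x1, x2}) - S" using X(1) by blast
      have fin: "finite (E `` S - S)" using finite_subset[OF _ fin, of "E `` S - S"] E_sub by blast
      have "3 \<le> card (E `` S - S)" using expansion[OF S] X by simp
      then have "2 \<le> card (E `` S - S - {x3})"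
        using diff_card_le_card_Diff[of "{x3}" "E `` S - S"] by simp
      moreover have "finite (E `` S \<inter> (B \<union> {x1, x2}) - S)" using fin by (rule rev_finite_subset) auto
      ultimately show ?thesis using card_mono[OF _ sub] by linarith
    qed
    then obtain F1 F2 where F: "F1 \<union> F2 = B \<union> {x1, x2}" "F1 \<inter> F2 = {}" "x1 \<in> F1" "x2 \<in> F2"
        "linked E F1" "linked E F2" "q \<in> F1 \<and> q' \<in> F2 \<or> q' \<in> F1 \<and> q \<in> F2"
      using split_linked[OF E_sym fin_parts(3) D(3)[unfolded True] X(2) xB(1,2) _ q(1-3)] by metis
    \<comment> \<open>\<open>F1\<close> contains exactly one of \<open>q\<close> and
      \<open>q'\<close>, so it cuts the connected set \<open>B\<close>; a crossing edge joins
      \<open>F1\<close> to \<open>F2\<close>.\<close>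
    have "F1 \<inter> B \<noteq> {}" "F1 \<inter> B \<noteq> B" "F1 \<inter> B \<subseteq> B" using F q by auto
    then obtain a b where ab: "a \<in> F1 \<inter> B" "b \<in> B - F1 \<inter> B" "(a, b) \<in> E"
      using linkedD[OF D(3)[unfolded True]] by metis
    then have "\<exists>a\<in>F1. \<exists>b\<in>F2. (a, b) \<in> E" using F(1) by blast
    moreover have "\<exists>a\<in>F1. (x3, a) \<in> E" "\<exists>a\<in>F2. (x3, a) \<in> E" using F(7) q(4,5) by auto
    moreover have "F1 \<subseteq> insert x1 B" "F2 \<subseteq> insert x2 B" using F(1-4) by auto
    ultimately show ?thesis using F(2-6) by blast
  qed
qed

end

section \<open>The smaller cover\<close>

locale good_separated = min_separated +
  assumes good: "good_side E F \<pi> X A"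
begin

definition rep :: "'b \<Rightarrow> 'a" where
  "rep = inv_into X \<pi>"

text \<open>On \<open>A \<union> X\<close>, where it is applied, this is the quotient map merging
  each fibre of \<open>X\<close> into its representative.\<close>

definition \<rho> :: "'a \<Rightarrow> 'a" where
  "\<rho> v = (if v \<in> A then v else rep (\<pi> v))"

text \<open>
  Two representatives are joined whenever the edge of the base graph below them is not already
  realised by an edge into \<open>A\<close>.
\<close>

definition H :: "'a pair_pre_digraph" where
  "H = \<lparr>pverts = A \<union> rep ` Y,
     parcs = {(\<rho> a, \<rho> b) | a b. (a, b) \<in> E \<and> (a \<in> A \<and> b \<in> A \<union> X \<or> a \<in> X \<and> b \<in> A)} \<union>
       {(rep y, rep y') | y y'. (y, y') \<in> F \<and> y \<in> Y \<and> y' \<in> Y \<and> T A y y' = {}}\<rparr>"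

lemma out_1: "y \<in> Y \<Longrightarrow> d A y = 1"
  and hits_le_1: "y \<in> Y \<Longrightarrow> y' \<in> Y \<Longrightarrow> card (T A y y') \<le> 1"
  using good by (auto simp: good_side_def)

lemma rep: "y \<in> Y \<Longrightarrow> rep y \<in> X" "y \<in> Y \<Longrightarrow> \<pi> (rep y) = y"
  by (simp_all add: rep_def inv_into_into f_inv_into_f)

lemma rep_notin: "y \<in> Y \<Longrightarrow> rep y \<notin> A"
  using rep(1) parts(2) by blast

lemma proj_\<rho>: "v \<in> A \<union> X \<Longrightarrow> \<pi> (\<rho> v) = \<pi> v"
  by (auto simp: \<rho>_def rep)

lemma \<rho>_A: "v \<in> A \<Longrightarrow> \<rho> v = v"
  by (simp add: \<rho>_def)

lemma \<rho>_X: "x \<in> X \<Longrightarrow> \<rho> x = rep (\<pi> x)"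
  using parts(2) by (auto simp: \<rho>_def)

lemma pverts_H: "pverts H = A \<union> rep ` Y"
  by (simp add: H_def)

lemma edge_H_side: "(a, b) \<in> E \<Longrightarrow> a \<in> A \<and> b \<in> A \<union> X \<or> a \<in> X \<and> b \<in> A \<Longrightarrow> (\<rho> a, \<rho> b) \<in> parcs H"
  unfolding H_def by auto

lemma edge_H_rep:
  "(y, y') \<in> F \<Longrightarrow> y \<in> Y \<Longrightarrow> y' \<in> Y \<Longrightarrow> T A y y' = {} \<Longrightarrow> (rep y, rep y') \<in> parcs H"
  unfolding H_def by auto

lemma edge_H_cases:
  assumes "(p, q) \<in> parcs H"
  obtains (side) a b where "p = \<rho> a" "q = \<rho> b" "(a, b) \<in> E" "a \<in> A \<and> b \<in> A \<union> X \<or> a \<in> X \<and> b \<in> A"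
    | (fibre) y y' where "p = rep y" "q = rep y'" "(y, y') \<in> F" "y \<in> Y" "y' \<in> Y" "T A y y' = {}"
  using assms unfolding H_def by auto

text \<open>\<open>d A\<close> is constantly 1 on a good side, so the balance equates both hit
  counts. Hence the added edges are symmetric.\<close>

lemma hits_sym:
  assumes "y \<in> Y" "y' \<in> Y" "(y, y') \<in> F" "T A y y' = {}"
  shows "T A y' y = {}"
proof -
  have "card (T A y' y) = 0"
    using out_balance[OF assms(1-3)] out_1[OF assms(1)] out_1[OF assms(2)] assms(4) by simp
  moreover have "finite (T A y' y)" using fin_parts(1) by (simp add: hits_def)
  ultimately show ?thesis by simp
qed

lemma H_proj: "(p, q) \<in> parcs H \<Longrightarrow> (\<pi> p, \<pi> q) \<in> F"
proof (erule edge_H_cases)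
  fix a b assume *: "p = \<rho> a" "q = \<rho> b" "(a, b) \<in> E" "a \<in> A \<and> b \<in> A \<union> X \<or> a \<in> X \<and> b \<in> A"
  then have "\<pi> p = \<pi> a" "\<pi> q = \<pi> b" using proj_\<rho>[of a] proj_\<rho>[of b] by auto
  then show ?thesis using proj_edge[OF *(3)] by simp
qed (simp add: rep)

lemma pair_graph_H: "pair_graph H"
  unfolding pair_graph_iff
proof (intro conjI)
  show "finite (pverts H)" using fin_parts by (simp add: pverts_H)
  have \<rho>_in: "\<rho> v \<in> pverts H" if "v \<in> A \<union> X" for v
    using that by (auto simp: pverts_H \<rho>_def)
  show "parcs H \<subseteq> pverts H \<times> pverts H"
  proof safe
    fix p q assume "(p, q) \<in> parcs H"
    then have "p \<in> pverts H \<and> q \<in> pverts H"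
      by (cases rule: edge_H_cases) (use \<rho>_in in \<open>auto simp: pverts_H\<close>)
    then show "p \<in> pverts H" "q \<in> pverts H" by auto
  qed
  show "sym (parcs H)"
  proof (rule symI)
    fix p q assume "(p, q) \<in> parcs H"
    then show "(q, p) \<in> parcs H"
    proof (cases rule: edge_H_cases)
      case (side a b)
      then show ?thesis using edge_H_side[OF edge_sym[OF side(3)]] side_nbr by auto
    next
      case (fibre y y')
      then show ?thesis using edge_H_rep[of y' y] hits_sym F_sym by (auto dest: symD)
    qed
  qed
  show "irrefl (parcs H)" using H_proj no_loop by (auto simp: irrefl_def)
qed

lemma card_H_less: "card (pverts H) < card V"
proof -
  have "pverts H \<subseteq> A \<union> X" using rep(1) by (auto simp: pverts_H)
  then have "pverts H \<subset> V" using parts(1,3,4,6) by blast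
  then show ?thesis by (rule psubset_card_mono[OF fin])
qed

lemma outer_hit:
  assumes "y \<in> Y" "(y, v) \<in> F" "v \<notin> Y" shows "card (T A y v) = 1"
  using card_hits_eq_out[OF assms] out_1[OF assms(1)] by simp

text \<open>\<open>A\<close> has a vertex over some point outside \<open>Y\<close>, so the constant
  fibre size over \<open>W - Y\<close> is not 0.\<close>

lemma proj_H_onto: "\<pi> ` pverts H = W"
proof
  show "\<pi> ` pverts H \<subseteq> W" using rep(1) parts(1) onto by (auto simp: pverts_H)
  have "\<exists>a\<in>A. \<pi> a \<notin> Y"
  proof (cases "Y = {}")
    case True
    then show ?thesis using parts(5) by auto
  next
    case False
    then obtain y v where yv: "y \<in> Y" "(y, v) \<in> F" "v \<notin> Y" using outer_nbr by blast
    then have "T A y v \<noteq> {}" using outer_hit[OF yv] by auto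
    then show ?thesis using yv by (auto simp: hits_def)
  qed
  then obtain a where a: "a \<in> A" "\<pi> a \<notin> Y" by blast
  from count_constant obtain m where m: "\<forall>v\<in>W - Y. card {a\<in>A. \<pi> a = v} = m" ..
  have "m = card {a'\<in>A. \<pi> a' = \<pi> a}" using m a parts(1) onto by auto
  then have "m \<noteq> 0" using a(1) fin_parts(2) by auto
  show "W \<subseteq> \<pi> ` pverts H"
  proof
    fix v assume v: "v \<in> W"
    show "v \<in> \<pi> ` pverts H"
    proof (cases "v \<in> Y")
      case True
      then have "v = \<pi> (rep v)" "rep v \<in> pverts H" by (simp_all add: rep(2) pverts_H)
      then show ?thesis by (rule image_eqI)
    next
      case False
      then have "card {a\<in>A. \<pi> a = v} \<noteq> 0" using m v \<open>m \<noteq> 0\<close> by auto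
      then have "{a\<in>A. \<pi> a = v} \<noteq> {}" by (metis card.empty)
      then show ?thesis by (auto simp: pverts_H)
    qed
  qed
qed

lemma nbr_H_A:
  assumes "p \<in> A" "(p, q) \<in> parcs H"
  obtains b where "(p, b) \<in> E" "b \<in> A \<union> X" "q = \<rho> b"
  using assms(2)
proof (cases rule: edge_H_cases)
  case (side a b)
  have "a \<in> A"
  proof (rule ccontr)
    assume "a \<notin> A"
    then have "a \<in> X" using side by auto
    then show False using side(1) assms(1) \<rho>_X[of a] rep_notin[of "\<pi> a"] by auto
  qed
  then show ?thesis using side that[of b] \<rho>_A[of a] by auto
next
  case (fibre y y')
  then show ?thesis using assms(1) rep_notin by auto
qed

lemma nbr_H_rep:
  assumes "y \<in> Y" "(rep y, q) \<in> parcs H"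
  obtains (A) x where "q \<in> A" "x \<in> fib y" "(x, q) \<in> E"
    | (fibre) y' where "y' \<in> Y" "q = rep y'" "T A y y' = {}"
  using assms(2)
proof (cases rule: edge_H_cases)
  case (side a b)
  have "a \<notin> A"
  proof
    assume "a \<in> A"
    then show False using side(1) \<rho>_A[of a] rep_notin[OF assms(1)] by simp
  qed
  then have ab: "a \<in> X" "b \<in> A" using side(4) by auto
  then have "\<pi> a = y" using side(1) \<rho>_X[OF ab(1)] rep(2)[of "\<pi> a"] rep(2)[OF assms(1)] by simp
  then show ?thesis using A[of a] ab side(2,3) \<rho>_A[OF ab(2)] by auto
next
  case (fibre z y')
  then have "z = y" using assms(1) fibre(1,4) rep(2) by metis
  then show ?thesis using fibre that(2) by auto
qed

text \<open>Merging fibres does not change the projected neighbours of a vertex of \<open>A\<close>.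
  At a representative, goodness lets the side edges supply each neighbour at most once, and the
  added edges supply exactly the missing ones.\<close>

lemma covering_H: "v \<in> pverts H \<Longrightarrow> bij_betw \<pi> (parcs H `` {v}) (F `` {\<pi> v})"
proof -
  assume v: "v \<in> pverts H"
  have inj: "q = q'" if q: "(v, q) \<in> parcs H" "(v, q') \<in> parcs H" "\<pi> q = \<pi> q'" for q q'
  proof (cases "v \<in> A")
    case True
    obtain b where b: "(v, b) \<in> E" "b \<in> A \<union> X" "q = \<rho> b" by (rule nbr_H_A[OF True q(1)])
    obtain b' where b': "(v, b') \<in> E" "b' \<in> A \<union> X" "q' = \<rho> b'" by (rule nbr_H_A[OF True q(2)])
    have "\<pi> b = \<pi> b'" using q(3) b b' proj_\<rho> by metis
    then show ?thesis using lift_unique[OF b(1) b'(1)] b(3) b'(3) by simp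
  next
    case False
    then obtain y where y: "y \<in> Y" "v = rep y" using v by (auto simp: pverts_H)
    have mixed: False if "(rep y, q) \<in> parcs H" "q \<in> A" "x \<in> fib y" "(x, q) \<in> E" "T A y (\<pi> q) = {}" for q x
      using that by (auto simp: hits_def)
    show ?thesis
      using q(1)[unfolded y(2)]
    proof (cases rule: nbr_H_rep[OF y(1), consumes 1, case_names side fibre])
      case (side x)
      note x = this
      show ?thesis
        using q(2)[unfolded y(2)]
      proof (cases rule: nbr_H_rep[OF y(1), consumes 1, case_names side fibre])
        case (side x')
        note x' = this
        \<comment> \<open>Both edges come from points of one hit set of size at most 1, hence from
          the same point of \<open>X\<close>.\<close>
        have "(y, \<pi> q) \<in> F" using H_proj[OF q(1)] y rep(2) by simp
        then have "card (T A y (\<pi> q)) \<le> 1"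
          using outer_hit[OF y(1)] hits_le_1[OF y(1)] by (cases "\<pi> q \<in> Y") auto
        moreover have "x \<in> T A y (\<pi> q)" "x' \<in> T A y (\<pi> q)"
          using x x' q(3) by (auto simp: hits_def)
        moreover have "finite (T A y (\<pi> q))" using fin_parts(1) by (simp add: hits_def)
        ultimately have "x = x'" by (auto simp: card_le_Suc0_iff_eq)
        then show ?thesis using lift_unique[OF x(3), of q'] x'(3) q(3) by simp
      next
        case (fibre y')
        then have "T A y (\<pi> q) = {}" using q(3) rep(2) by simp
        then show ?thesis using mixed q(1) y(2) x by blast
      qed
    next
      case (fibre y')
      note y' = this
      show ?thesis
        using q(2)[unfolded y(2)]
      proof (cases rule: nbr_H_rep[OF y(1), consumes 1, case_names side fibre])
        case (side x)
        moreover have "T A y (\<pi> q') = {}" using y' q(3) rep(2) by simp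
        ultimately show ?thesis using mixed q(2) y(2) by blast
      next
        case (fibre y'')
        then show ?thesis using y' q(3) rep(2) by simp
      qed
    qed
  qed
  have surj: "\<exists>q. (v, q) \<in> parcs H \<and> \<pi> q = w" if w: "(\<pi> v, w) \<in> F" for w
  proof (cases "v \<in> A")
    case True
    then obtain b where b: "(v, b) \<in> E" "\<pi> b = w" using lift_exists[of v w] w parts(1) by auto
    moreover have bAX: "b \<in> A \<union> X" using side_nbr[OF True b(1)] .
    ultimately have "(\<rho> v, \<rho> b) \<in> parcs H" using True by (intro edge_H_side) auto
    then show ?thesis using \<rho>_A[OF True] proj_\<rho>[OF bAX] b(2) by auto
  next
    case False
    then obtain y where y: "y \<in> Y" "v = rep y" using v by (auto simp: pverts_H)
    then have yw: "(y, w) \<in> F" using w rep(2) by simp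
    show ?thesis
    proof (cases "T A y w = {}")
      case True
      \<comment> \<open>Outer neighbours are always hit, so a missing neighbour lies in
        \<open>Y\<close>.\<close>
      then have "w \<in> Y" using outer_hit[OF y(1) yw] by auto
      then have "(rep y, rep w) \<in> parcs H" "\<pi> (rep w) = w"
        using edge_H_rep[OF yw y(1) _ True] rep(2) by auto
      then show ?thesis using y(2) by blast
    next
      case False
      then obtain x a where xa: "x \<in> X" "\<pi> x = y" "a \<in> A" "(x, a) \<in> E" "\<pi> a = w"
        by (auto simp: hits_def)
      then have "(\<rho> x, \<rho> a) \<in> parcs H" by (intro edge_H_side) auto
      then show ?thesis using xa \<rho>_X \<rho>_A y(2) by auto
    qed
  qed
  show ?thesis
    unfolding bij_betw_def
  proof
    show "inj_on \<pi> (parcs H `` {v})" using inj by (auto intro: inj_onI)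
    show "\<pi> ` parcs H `` {v} = F `` {\<pi> v}"
    proof (intro equalityI subsetI)
      fix w assume "w \<in> F `` {\<pi> v}"
      then obtain q where "(v, q) \<in> parcs H" "\<pi> q = w" using surj by blast
      then show "w \<in> \<pi> ` parcs H `` {v}" by blast
    qed (use H_proj in blast)
  qed
qed

section \<open>Planarity of the smaller cover\<close>

text \<open>Vertices of \<open>A\<close> stay singleton branch sets, and \<open>g\<close>
  distributes \<open>X \<union> D\<close> among the points of \<open>Y\<close>. Side edges are
  inherited from \<open>E\<close>, so only the added edges need to be realised.\<close>

lemma planar_H_if_model:
  assumes G: "pair_graph G" "planar G" "pverts G = V" "parcs G = E"
    and D: "D \<subseteq> B" and gX: "\<And>x. x \<in> X \<Longrightarrow> g x = \<pi> x" and gD: "\<And>b. b \<in> D \<Longrightarrow> g b \<in> Y"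
    and linked: "\<And>y. y \<in> Y \<Longrightarrow> linked E {u \<in> X \<union> D. g u = y}"
    and edge: "\<And>y y'. y \<in> Y \<Longrightarrow> y' \<in> Y \<Longrightarrow> (y, y') \<in> F \<Longrightarrow> T A y y' = {} \<Longrightarrow>
      \<exists>u \<in> X \<union> D. \<exists>v \<in> X \<union> D. g u = y \<and> g v = y' \<and> (u, v) \<in> E"
  shows "planar H"
proof (rule planar_minor[OF G(1,2)])
  define f where "f u = (if u \<in> A then u else rep (g u))" for u
  have fA: "f u = u" if "u \<in> A" for u using that by (simp add: f_def)
  have fXD: "f u = rep (g u)" "g u \<in> Y" if "u \<in> X \<union> D" for u
    using that parts(2,4) D gX gD by (auto simp: f_def)
  have f\<rho>: "f u = \<rho> u" if "u \<in> A \<union> X" for u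
    using that
  proof
    assume "u \<in> X"
    then show ?thesis using fXD(1)[of u] gX[of u] \<rho>_X[of u] by simp
  qed (simp add: fA \<rho>_A)
  show "A \<union> X \<union> D \<subseteq> pverts G" using D parts(1) G(3) by auto
  show "irrefl (parcs H)" using pair_graph_H by (simp add: pair_graph_iff)
  show "f ` (A \<union> X \<union> D) = pverts H"
  proof (intro equalityI subsetI)
    fix w assume "w \<in> f ` (A \<union> X \<union> D)"
    then obtain u where "u \<in> A \<or> u \<in> X \<union> D" "w = f u" by auto
    then show "w \<in> pverts H" using fA[of u] fXD[of u] by (auto simp: pverts_H)
  next
    fix w assume "w \<in> pverts H"
    then consider "w \<in> A" | x where "x \<in> X" "w = rep (\<pi> x)" by (auto simp: pverts_H)
    then show "w \<in> f ` (A \<union> X \<union> D)"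
    proof cases
      case 1
      then show ?thesis using fA[of w] by (intro image_eqI[of _ _ w]) auto
    next
      case (2 x)
      then show ?thesis using fXD[of x] gX[of x] by (intro image_eqI[of _ _ x]) auto
    qed
  qed
  show "linked (parcs G) {u \<in> A \<union> X \<union> D. f u = w}" if w: "w \<in> pverts H" for w
  proof (cases "w \<in> A")
    case True
    have "u = w" if u: "u \<in> X \<union> D" "f u = w" for u
      using fXD[OF u(1)] rep_notin[of "g u"] u(2) True by simp
    then have "{u \<in> A \<union> X \<union> D. f u = w} = {w}" using True fA by auto
    then show ?thesis by (simp add: linked_singleton)
  next
    case False
    then obtain y where y: "y \<in> Y" "w = rep y" using w by (auto simp: pverts_H)
    have "f u = w \<longleftrightarrow> g u = y" if "u \<in> X \<union> D" for u
      unfolding fXD(1)[OF that] y(2) using rep(2)[OF fXD(2)[OF that]] rep(2)[OF y(1)] by metis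
    moreover have "f u \<noteq> w" if "u \<in> A" for u using that fA False by auto
    ultimately have "{u \<in> A \<union> X \<union> D. f u = w} = {u \<in> X \<union> D. g u = y}" by blast
    then show ?thesis using linked[OF y(1)] G(4) by simp
  qed
  show "\<exists>u\<in>A \<union> X \<union> D. \<exists>v\<in>A \<union> X \<union> D. f u = p \<and> f v = q \<and> (u, v) \<in> parcs G"
    if "(p, q) \<in> parcs H" for p q
    using that
  proof (cases rule: edge_H_cases)
    case (side a b)
    then have "f a = p" "f b = q" "a \<in> A \<union> X \<union> D" "b \<in> A \<union> X \<union> D" using f\<rho> by auto
    then show ?thesis using side(3) G(4) by blast
  next
    case (fibre y y')
    obtain u v where "u \<in> X \<union> D" "v \<in> X \<union> D" "g u = y" "g v = y'" "(u, v) \<in> E"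
      using edge[OF fibre(4,5,3,6)] by blast
    moreover from this have "f u = p" "f v = q" using fXD(1) fibre(1,2) by auto
    ultimately show ?thesis unfolding G(4) by blast
  qed
qed

text \<open>A component of \<open>B\<close> is contracted into the fibre over \<open>y0\<close>. It
  touches all of \<open>X\<close>, so every added edge at \<open>y0\<close> is realised; those
  avoiding \<open>y0\<close> must come from edges inside \<open>X\<close>.\<close>

lemma planar_H_star:
  assumes G: "pair_graph G" "planar G" "pverts G = V" "parcs G = E"
    and y0: "y0 \<in> Y" and single: "\<And>y. y \<in> Y \<Longrightarrow> y \<noteq> y0 \<Longrightarrow> card (fib y) = 1"
    and edge: "\<And>y y'. y \<in> Y - {y0} \<Longrightarrow> y' \<in> Y - {y0} \<Longrightarrow> (y, y') \<in> F \<Longrightarrow> T A y y' = {} \<Longrightarrow>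
      \<exists>x \<in> fib y. \<exists>x' \<in> fib y'. (x, x') \<in> E"
  shows "planar H"
proof -
  obtain b where "b \<in> B" using parts(6) by auto
  then obtain D where D: "D \<subseteq> B" "linked E D" "\<And>x. x \<in> X \<Longrightarrow> \<exists>e\<in>D. (x, e) \<in> E"
    using touching_component by metis
  define g where "g u = (if u \<in> X then \<pi> u else y0)" for u
  have gX: "g x = \<pi> x" if "x \<in> X" for x using that by (simp add: g_def)
  have gD: "g e = y0" if "e \<in> D" for e using that D(1) parts(3) by (auto simp: g_def)
  show ?thesis
  proof (rule planar_H_if_model[OF G D(1) gX])
    show "g b \<in> Y" if "b \<in> D" for b using gD[OF that] y0 by simp
    show "linked E {u \<in> X \<union> D. g u = y}" if y: "y \<in> Y" for y
    proof (cases "y = y0")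
      case True
      then have "{u \<in> X \<union> D. g u = y} = D \<union> fib y0" using gX gD by auto
      then show ?thesis using linked_Un_adjacent[OF D(2) E_sym, of "fib y0"] D(3) by simp
    next
      case False
      then have "{u \<in> X \<union> D. g u = y} = fib y" using gX gD by auto
      then show ?thesis using single[OF y False] linked_singleton by (metis card_1_singletonE)
    qed
    have to_y0: "\<exists>u\<in>D. \<exists>x\<in>X. g u = y0 \<and> g x = y \<and> (u, x) \<in> E \<and> (x, u) \<in> E" if "y \<in> Y" for y
    proof -
      obtain x where x: "x \<in> X" "\<pi> x = y" using \<open>y \<in> Y\<close> by auto
      then obtain e where "e \<in> D" "(x, e) \<in> E" using D(3) by blast
      then show ?thesis using x gX gD edge_sym by blast
    qed
    show "\<exists>u\<in>X \<union> D. \<exists>v\<in>X \<union> D. g u = y \<and> g v = y' \<and> (u, v) \<in> E"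
      if y: "y \<in> Y" "y' \<in> Y" "(y, y') \<in> F" "T A y y' = {}" for y y'
    proof -
      consider "y = y0" | "y' = y0" | "y \<in> Y - {y0}" "y' \<in> Y - {y0}" using y by blast
      then show ?thesis
      proof cases
        case 1
        then show ?thesis using to_y0[OF y(2)] by blast
      next
        case 2
        then show ?thesis using to_y0[OF y(1)] by blast
      next
        case 3
        obtain x x' where "x \<in> fib y" "x' \<in> fib y'" "(x, x') \<in> E" using edge[OF 3 y(3,4)] by blast
        then show ?thesis using gX by blast
      qed
    qed
  qed
qed

text \<open>The neighbour of \<open>x\<close> over \<open>\<pi> x'\<close> is not in
  \<open>A\<close>, as there is no hit, nor in \<open>X\<close>, where injectivity would make it
  \<open>x'\<close>.\<close>

lemma other_side_nbr:
  assumes "inj_on \<pi> X" "x \<in> X" "x' \<in> X" "(\<pi> x, \<pi> x') \<in> F" "T A (\<pi> x) (\<pi> x') = {}" "(x, x') \<notin> E"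
  obtains q where "q \<in> B" "(x, q) \<in> E" "\<pi> q = \<pi> x'"
proof -
  obtain q where q: "(x, q) \<in> E" "\<pi> q = \<pi> x'" using lift_exists[of x] assms(2,4) parts(1) by auto
  have "q \<notin> A" using q assms(2,5) by (auto simp: hits_def)
  moreover have "q \<notin> X"
  proof
    assume "q \<in> X"
    then have "q = x'" using inj_onD[OF assms(1) q(2)] assms(3) by simp
    then show False using q(1) assms(6) by simp
  qed
  moreover have "q \<in> V" using E_sub q(1) by auto
  ultimately show ?thesis using that q parts(1) by auto
qed

text \<open>Stars centred at \<open>x1\<close> and \<open>x2\<close> are tried first. If both fail,
  \<open>x3\<close> has distinct neighbours in \<open>B\<close> over \<open>\<pi> x1\<close> and
  \<open>\<pi> x2\<close>, and \<open>triangle\<close> realises all edges on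
  \<open>Y\<close>.\<close>

lemma planar_H_three:
  assumes G: "pair_graph G" "planar G" "pverts G = V" "parcs G = E" and "card Y = 3"
  shows "planar H"
proof -
  have "card X = 3" using card_X card_image_le[OF fin_parts(1), of \<pi>] assms(5) by linarith
  then have inj: "inj_on \<pi> X" using assms(5) by (intro eq_card_imp_inj_on[OF fin_parts(1)]) simp
  obtain x1 x2 x3 where X: "X = {x1, x2, x3}" "x1 \<noteq> x2" "x1 \<noteq> x3" "x2 \<noteq> x3"
    using \<open>card X = 3\<close> by (auto simp: card_3_iff)
  \<comment> \<open>With centre \<open>x\<close> only the pair \<open>x3\<close>, \<open>x'\<close>
    remains. If an added edge there is not an edge of \<open>G\<close>, its lift at
    \<open>x3\<close> ends in \<open>B\<close>.\<close>
  have star: "planar H \<or> (\<exists>q\<in>B. (x3, q) \<in> E \<and> \<pi> q = \<pi> x')"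
    if X': "X = {x, x', x3}" "x \<noteq> x3" "x' \<noteq> x3" for x x'
  proof (rule disjCI)
    assume no: "\<not> (\<exists>q\<in>B. (x3, q) \<in> E \<and> \<pi> q = \<pi> x')"
    have xs: "x \<in> X" "x' \<in> X" "x3 \<in> X" using X'(1) by auto
    have adj: "(x3, x') \<in> E" if "(\<pi> x3, \<pi> x') \<in> F" "T A (\<pi> x3) (\<pi> x') = {}"
      using other_side_nbr[OF inj xs(3,2) that] no by blast
    show "planar H"
    proof (rule planar_H_star[OF G])
      show "\<pi> x \<in> Y" using xs by simp
      show "card (fib y) = 1" if "y \<in> Y" for y using card_fib_inj[OF inj that] .
      show "\<exists>u\<in>fib y. \<exists>u'\<in>fib y'. (u, u') \<in> E"
        if y: "y \<in> Y - {\<pi> x}" "y' \<in> Y - {\<pi> x}" "(y, y') \<in> F" "T A y y' = {}" for y y'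
      proof -
        have "y \<noteq> y'" using y(3) no_loop by auto
        then consider "y = \<pi> x3" "y' = \<pi> x'" | "y = \<pi> x'" "y' = \<pi> x3"
          using y(1,2) unfolding X'(1) by auto
        then show ?thesis
        proof cases
          case 1
          then show ?thesis using adj y(3,4) xs by auto
        next
          case 2
          then have "(x3, x') \<in> E"
            using adj hits_sym[of y y'] y F_sym by (auto dest: symD)
          then show ?thesis using edge_sym[of x3 x'] 2 xs by auto
        qed
      qed
    qed
  qed
  show ?thesis
  proof (rule ccontr)
    assume npl: "\<not> planar H"
    have "X = {x2, x1, x3}" using X(1) by auto
    then obtain q q' where q: "q \<in> B" "(x3, q) \<in> E" "\<pi> q = \<pi> x2" "q' \<in> B" "(x3, q') \<in> E" "\<pi> q' = \<pi> x1"
      using star[of x1 x2] star[of x2 x1] npl X by blast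
    have pi_ne: "\<pi> x1 \<noteq> \<pi> x2" "\<pi> x1 \<noteq> \<pi> x3" "\<pi> x2 \<noteq> \<pi> x3"
      using inj X by (auto simp: inj_on_def)
    then have "q \<noteq> q'" using q by auto
    then obtain F1 F2 where F: "F1 \<subseteq> insert x1 B" "F2 \<subseteq> insert x2 B" "F1 \<inter> F2 = {}" "x1 \<in> F1"
        "x2 \<in> F2" "linked E F1" "linked E F2" "\<exists>a\<in>F1. \<exists>b\<in>F2. (a, b) \<in> E"
        "\<exists>a\<in>F1. (x3, a) \<in> E" "\<exists>a\<in>F2. (x3, a) \<in> E"
      using triangle[OF X q(1,4) _ q(2,5)] by metis
    define D where "D = (F1 \<union> F2) \<inter> B"
    \<comment> \<open>On \<open>X \<union> D\<close> the last value is taken only at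
      \<open>x3\<close>, which forms a branch set alone.\<close>
    define g where "g u = (if u \<in> F1 then \<pi> x1 else if u \<in> F2 then \<pi> x2 else \<pi> x3)" for u
    have xB: "x1 \<notin> B" "x2 \<notin> B" "x3 \<notin> B" using X(1) parts(3) by auto
    have XD: "X \<union> D = F1 \<union> F2 \<union> {x3}" using F(1,2,4,5) by (auto simp: D_def X(1))
    have x3: "x3 \<notin> F1" "x3 \<notin> F2" using F(1,2) X xB by auto
    have g1: "g u = \<pi> x1" if "u \<in> F1" for u using that by (simp add: g_def)
    have g2: "g u = \<pi> x2" if "u \<in> F2" for u using that F(3) by (auto simp: g_def)
    have g3: "g x3 = \<pi> x3" using x3 by (simp add: g_def)
    have Y: "Y = {\<pi> x1, \<pi> x2, \<pi> x3}" using X(1) by simp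
    have "planar H"
    proof (rule planar_H_if_model[OF G, of D g])
      show "D \<subseteq> B" by (simp add: D_def)
      show "g x = \<pi> x" if "x \<in> X" for x using that g1[OF F(4)] g2[OF F(5)] g3 X(1) by auto
      show "g b \<in> Y" if "b \<in> D" for b using that g1[of b] g2[of b] Y by (auto simp: D_def)
      show "linked E {u \<in> X \<union> D. g u = y}" if "y \<in> Y" for y
      proof -
        have "{u \<in> X \<union> D. g u = \<pi> x1} = F1" "{u \<in> X \<union> D. g u = \<pi> x2} = F2"
          "{u \<in> X \<union> D. g u = \<pi> x3} = {x3}"
          unfolding XD using g1 g2 g3 pi_ne by auto
        then show ?thesis using that F(6,7) linked_singleton Y by auto
      qed
      have e12: "\<exists>u\<in>X \<union> D. \<exists>v\<in>X \<union> D. g u = \<pi> x1 \<and> g v = \<pi> x2 \<and> (u, v) \<in> E"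
        unfolding XD using F(8) g1 g2 by blast
      have e31: "\<exists>u\<in>X \<union> D. \<exists>v\<in>X \<union> D. g u = \<pi> x3 \<and> g v = \<pi> x1 \<and> (u, v) \<in> E"
        unfolding XD using F(9) g1 g3 by blast
      have e32: "\<exists>u\<in>X \<union> D. \<exists>v\<in>X \<union> D. g u = \<pi> x3 \<and> g v = \<pi> x2 \<and> (u, v) \<in> E"
        unfolding XD using F(10) g2 g3 by blast
      have flip: "\<exists>u\<in>X \<union> D. \<exists>v\<in>X \<union> D. g u = z' \<and> g v = z \<and> (u, v) \<in> E"
        if "\<exists>u\<in>X \<union> D. \<exists>v\<in>X \<union> D. g u = z \<and> g v = z' \<and> (u, v) \<in> E" for z z'
        using that edge_sym by blast
      show "\<exists>u\<in>X \<union> D. \<exists>v\<in>X \<union> D. g u = y \<and> g v = y' \<and> (u, v) \<in> E"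
        if y: "y \<in> Y" "y' \<in> Y" "(y, y') \<in> F" for y y'
      proof -
        have "y \<noteq> y'" using y(3) no_loop by auto
        then consider "y = \<pi> x1" "y' = \<pi> x2" | "y = \<pi> x2" "y' = \<pi> x1" | "y = \<pi> x3" "y' = \<pi> x1"
          | "y = \<pi> x1" "y' = \<pi> x3" | "y = \<pi> x3" "y' = \<pi> x2" | "y = \<pi> x2" "y' = \<pi> x3"
          using y(1,2) unfolding Y by auto
        then show ?thesis
          by cases (use e12 e31 e32 flip[OF e12] flip[OF e31] flip[OF e32] in simp_all)
      qed
    qed
    then show False using npl by simp
  qed
qed

lemma planar_H:
  assumes G: "pair_graph G" "planar G" "pverts G = V" "parcs G = E"
  shows "planar H"
proof -
  have finY: "finite Y" using fin_parts by simp
  consider "card Y = 0" | "card Y = 1" | "card Y = 2" | "card Y = 3" using card_Y by linarith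
  then show ?thesis
  proof cases
    case 1
    then have "X = {}" using fin_parts by simp
    then show ?thesis by (intro planar_H_if_model[OF G, of "{}" \<pi>]) auto
  next
    case 2
    then obtain y where y: "Y = {y}" by (rule card_1_singletonE)
    show ?thesis by (rule planar_H_star[OF G, of y]) (use y in auto)
  next
    case 3
    then obtain y z where Y: "Y = {y, z}" "y \<noteq> z" by (meson card_2_iff)
    \<comment> \<open>At most one of the two fibres has more than one point; the centre
      \<open>y\<close> is chosen so that the other fibre is a singleton.\<close>
    have star: ?thesis if "Y = {y, z}" "y \<noteq> z" "card (fib z) = 1" for y z
      by (rule planar_H_star[OF G, of y]) (use that no_loop in auto)
    have "card (fib y \<union> fib z) \<le> card X" using fin_parts by (intro card_mono) auto
    moreover have "card (fib y \<union> fib z) = card (fib y) + card (fib z)"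
      using Y fin_parts by (intro card_Un_disjoint) auto
    moreover have "card (fib y) \<ge> 1" "card (fib z) \<ge> 1" using card_fib_pos Y by auto
    ultimately consider "card (fib z) = 1" | "card (fib y) = 1" using card_X by linarith
    then show ?thesis
      by cases (use star[of y z] star[of z y] Y in auto)
  next
    case 4
    then show ?thesis by (rule planar_H_three[OF G])
  qed
qed

end

section \<open>Minimal planar covers\<close>

text \<open>Symmetrising a symmetric arc set changes nothing. The vertices reachable from
  \<open>u\<close> would form an uncrossed cut if they were not all of \<open>S\<close>; conversely,
  no path leaves an uncrossed cut.\<close>

lemma connected_induced_iff:
  assumes "pair_graph G" "S \<subseteq> pverts G"
  shows "Digraph_Component.connected (with_proj G \<restriction> S) \<longleftrightarrow> S \<noteq> {} \<and> linked (parcs G) S"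
proof -
  define M where "M = with_proj (mk_symmetric (with_proj G \<restriction> S))"
  have sym: "sym (parcs G)" using assms(1) by (simp add: pair_graph_iff)
  have vM: "verts M = S" by (simp add: M_def mk_symmetric_def)
  have aM: "arcs_ends M = parcs G \<inter> (S \<times> S)"
    unfolding M_def mk_symmetric_def using sym
    by (auto simp: induce_subgraph_arcs dest: symD)
  have conn: "Digraph_Component.connected (with_proj G \<restriction> S) \<longleftrightarrow>
      S \<noteq> {} \<and> (\<forall>u\<in>S. \<forall>v\<in>S. (u, v) \<in> rtrancl_on S (parcs G \<inter> (S \<times> S)))"
    unfolding Digraph_Component.connected_def strongly_connected_def reachable_def
      M_def[symmetric] vM aM ..
  show ?thesis
    unfolding conn
  proof (intro conj_cong refl iffI ballI)
    assume *: "\<forall>u\<in>S. \<forall>v\<in>S. (u, v) \<in> rtrancl_on S (parcs G \<inter> (S \<times> S))"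
    show "linked (parcs G) S"
      unfolding linked_def
    proof (intro allI impI)
      fix Q assume Q: "Q \<subseteq> S" "Q \<noteq> {}" "Q \<noteq> S"
      then obtain u v where uv: "u \<in> Q" "v \<in> S - Q" by blast
      show "\<exists>a\<in>Q. \<exists>b\<in>S - Q. (a, b) \<in> parcs G"
      proof (rule ccontr)
        assume no: "\<not> ?thesis"
        have "w \<in> Q" if "(u, w) \<in> rtrancl_on S (parcs G \<inter> (S \<times> S))" for w
          using that
        proof (induction rule: rtrancl_on_induct)
          case base
          then show ?case using uv by simp
        next
          case (step x y)
          then show ?case using no by blast
        qed
        then show False using * uv Q by blast
      qed
    qed
  next
    fix u v assume L: "linked (parcs G) S" and uv: "u \<in> S" "v \<in> S"
    define R where "R = {w \<in> S. (u, w) \<in> rtrancl_on S (parcs G \<inter> (S \<times> S))}"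
    have "R = S"
    proof (rule ccontr)
      assume "R \<noteq> S"
      moreover have "u \<in> R" using uv by (simp add: R_def rtrancl_on_refl)
      then have "R \<noteq> {}" by auto
      moreover have "R \<subseteq> S" by (auto simp: R_def)
      ultimately obtain a b where ab: "a \<in> R" "b \<in> S - R" "(a, b) \<in> parcs G"
        using linkedD[OF L] by metis
      then have "(u, a) \<in> rtrancl_on S (parcs G \<inter> (S \<times> S))" "(a, b) \<in> parcs G \<inter> (S \<times> S)" "a \<in> S"
        by (auto simp: R_def)
      then have "(u, b) \<in> rtrancl_on S (parcs G \<inter> (S \<times> S))"
        using ab(2) by (blast intro: rtrancl_on_into_rtrancl_on)
      then show False using ab(2) by (auto simp: R_def)
    qed
    then show "(u, v) \<in> rtrancl_on S (parcs G \<inter> (S \<times> S))" using uv by (auto simp: R_def)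
  qed
qed

theorem theorem1:
  fixes K :: "'b pair_pre_digraph" and G :: "'a pair_pre_digraph"
  assumes "pair_graph K"
    and "vertex_connected 4 K"
    and "minimal_planar_cover G K"
  shows "vertex_connected 4 G"
proof -
  obtain \<pi> where G: "pair_graph G" "planar G" "covering_projection \<pi> G K"
    using assms(3) by (auto simp: minimal_planar_cover_def planar_cover_def)
  interpret cover "pverts G" "parcs G" "pverts K" "parcs K" \<pi>
    using G(1,3) assms(1) by unfold_locales (auto simp: pair_graph_iff covering_projection_def)
  have card_K: "card (pverts K) > 4" using assms(2) by (simp add: vertex_connected_def)
  have linked_K: "linked (parcs K) (pverts K - Y)" if "Y \<subseteq> pverts K" "card Y \<le> 3" for Y
  proof -
    have "Digraph_Component.connected (with_proj K \<restriction> (pverts K - Y))"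
      using assms(2) that by (simp add: vertex_connected_def)
    then show ?thesis using connected_induced_iff[OF assms(1), of "pverts K - Y"] by auto
  qed
  have card_G: "card (pverts G) > 4"
    using card_K card_image_le[OF fin, of \<pi>] unfolding onto by linarith
  have no_cut: False if X: "separates (pverts G) (parcs G) X A B" "card X \<le> 3" for X A B
  proof -
    \<comment> \<open>\<open>min_separated\<close> needs a cut of least size among all cuts, not
      just a small one.\<close>
    have "\<exists>X. (\<exists>A B. separates (pverts G) (parcs G) X A B) \<and>
        (\<forall>X'. (\<exists>A B. separates (pverts G) (parcs G) X' A B) \<longrightarrow> card X \<le> card X')"
      using X(1) by (intro ex_has_least_nat[of _ X]) auto
    then obtain X0 A0 B0 where min: "separates (pverts G) (parcs G) X0 A0 B0"
        "\<And>X' A B. separates (pverts G) (parcs G) X' A B \<Longrightarrow> card X0 \<le> card X'" by blast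
    have "min_separated (pverts G) (parcs G) (pverts K) (parcs K) \<pi> X0 A0 B0"
      using min min(2)[OF X(1)] X(2) linked_K card_K by unfold_locales auto
    then interpret M: min_separated "pverts G" "parcs G" "pverts K" "parcs K" \<pi> X0 A0 B0 .
    obtain A1 B1 where good: "good_separated (pverts G) (parcs G) (pverts K) (parcs K) \<pi> X0 A1 B1"
      using M.good_exists M.swap M.min_separated_axioms
      unfolding good_separated_def good_separated_axioms_def by blast
    interpret S: good_separated "pverts G" "parcs G" "pverts K" "parcs K" \<pi> X0 A1 B1 by (rule good)
    have "covering_projection \<pi> S.H K"
      unfolding covering_projection_def using S.proj_H_onto S.covering_H by simp
    then have "planar_cover S.H K"
      unfolding planar_cover_def using S.pair_graph_H S.planar_H[OF G(1,2) refl refl] by blast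
    then have "card (pverts G) \<le> card (pverts S.H)" by (rule minimal_planar_cover_le[OF assms(3)])
    then show False using S.card_H_less by linarith
  qed
  have "Digraph_Component.connected (with_proj G \<restriction> (pverts G - X))"
    if X: "X \<subseteq> pverts G" "card X < 4" for X
  proof -
    have ne: "pverts G - X \<noteq> {}"
    proof
      assume "pverts G - X = {}"
      then have "card (pverts G) \<le> card X" using fin X(1) by (intro card_mono) (auto intro: finite_subset)
      then show False using X(2) card_G by linarith
    qed
    have "linked (parcs G) (pverts G - X)"
    proof (rule ccontr)
      assume "\<not> ?thesis"
      \<comment> \<open>A set violating linkedness and the rest of \<open>pverts G - X\<close> are
        the two sides of a cut.\<close>
      then obtain Q where Q: "Q \<subseteq> pverts G - X" "Q \<noteq> {}" "Q \<noteq> pverts G - X"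
          "\<forall>a\<in>Q. \<forall>b\<in>pverts G - X - Q. (a, b) \<notin> parcs G"
        unfolding linked_def by blast
      then have "separates (pverts G) (parcs G) X Q (pverts G - X - Q)"
        unfolding separates_def using X(1) by blast
      moreover have "card X \<le> 3" using X(2) by simp
      ultimately show False by (rule no_cut)
    qed
    then show ?thesis using ne connected_induced_iff[OF G(1), of "pverts G - X"] by auto
  qed
  then show ?thesis using card_G by (simp add: vertex_connected_def)
qed

end
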